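(* Let $A$ be a non-trivial finitely generated group and $S_A$ a finite symmetric generating set of $A$ such that $(A,S_A)$ has unbounded depth. Let $B$ be any finitely generated abelian group and $S_B$ any finite symmetric generating set of $B$. Then $A\wr B$ has unbounded depth with respect to the standard generating set $S_A\cup S_B$.
   Context: For a group $G$ with finite symmetric generating set $S$, $\|g\|_S$ denotes the word length of $g\in G$. An element $g\in G$ is a dead end of $(G,S)$ if $\|gs\|_S\le \|g\|_S$ for all $s\in S$; its depth is the maximal $n\ge 1$ such that $\|gs_1\cdots s_k\|_S\le \|g\|_S$ for all $k\le n$ and all $s_1,\dots,s_k\in S$ (the depth is infinite if there is no maximal such $n$, which can happen only when $G$ is finite). $(G,S)$ has unbounded depth if for every $n\in\mathbb{N}$ there is a dead end of depth at least $n$ (in particular every finite group has unbounded depth); otherwise it has uniformly bounded depth. The wreath product $A\wr B$ is $\bigoplus_B A\rtimes B$, where $\bigoplus_B A$ is the group of finitely supported functions $f:B\to A$ with pointwise multiplication and $B$ acts by $(b\cdot f)(x)=f(b^{-1}x)$; so $(f,b)(f',b')=(f\,(b\cdot f'),bb')$. $B$ embeds by $b\mapsto(\mathbf 1,b)$ with $\mathbf 1$ the constant function $e_A$, and $A$ embeds by $a\mapsto(\delta^a,e_B)$ with $\delta^a(e_B)=a$ and $\delta^a(x)=e_A$ for $x\ne e_B$. Via these embeddings $S_A\cup S_B$ is a generating set of $A\wr B$, called standard. *)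

theory Defs
  imports "HOL-Algebra.Algebra" "HOL-Library.Extended_Nat"
begin

section \<open>Word length, dead ends and depth\<close>

definition finite_symmetric_generating_set :: "('a, 'm) monoid_scheme \<Rightarrow> 'a set \<Rightarrow> bool"
  where "finite_symmetric_generating_set G S \<longleftrightarrow>
    finite S \<and> S \<subseteq> carrier G \<and> (\<forall>s\<in>S. inv\<^bsub>G\<^esub> s \<in> S) \<and> generate G S = carrier G"

definition word_prod :: "('a, 'm) monoid_scheme \<Rightarrow> 'a list \<Rightarrow> 'a"
  where "word_prod G ws = foldr (\<otimes>\<^bsub>G\<^esub>) ws \<one>\<^bsub>G\<^esub>"

text \<open>Only meaningful for symmetric generating sets: inverses of elements of \<open>S\<close> are not
  added to the alphabet.\<close>

definition word_length :: "('a, 'm) monoid_scheme \<Rightarrow> 'a set \<Rightarrow> 'a \<Rightarrow> nat"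
  where "word_length G S g = (LEAST n. \<exists>ws\<in>lists S. length ws = n \<and> word_prod G ws = g)"

definition dead_end :: "('a, 'm) monoid_scheme \<Rightarrow> 'a set \<Rightarrow> 'a \<Rightarrow> bool"
  where "dead_end G S g \<longleftrightarrow>
    g \<in> carrier G \<and> (\<forall>s\<in>S. word_length G S (g \<otimes>\<^bsub>G\<^esub> s) \<le> word_length G S g)"

text \<open>For a dead end the supremum is over a non-empty, downward closed set of positive integers:
  it is the maximum if there is one, and \<open>\<infinity>\<close> otherwise.\<close>

definition dead_end_depth :: "('a, 'm) monoid_scheme \<Rightarrow> 'a set \<Rightarrow> 'a \<Rightarrow> enat"
  where "dead_end_depth G S g =
    Sup (enat ` {n. 1 \<le> n \<and>
      (\<forall>k\<le>n. \<forall>ws\<in>lists S. length ws = k \<longrightarrow>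
        word_length G S (g \<otimes>\<^bsub>G\<^esub> word_prod G ws) \<le> word_length G S g)})"

definition unbounded_depth :: "('a, 'm) monoid_scheme \<Rightarrow> 'a set \<Rightarrow> bool"
  where "unbounded_depth G S \<longleftrightarrow> (\<forall>n::nat. \<exists>g. dead_end G S g \<and> enat n \<le> dead_end_depth G S g)"


section \<open>Wreath products\<close>

definition wreath_shift :: "('b, 'n) monoid_scheme \<Rightarrow> 'b \<Rightarrow> ('b \<Rightarrow> 'a) \<Rightarrow> 'b \<Rightarrow> 'a"
  where "wreath_shift B b f = (\<lambda>x\<in>carrier B. f (inv\<^bsub>B\<^esub> b \<otimes>\<^bsub>B\<^esub> x))"

definition wreath_product ::
    "('a, 'm) monoid_scheme \<Rightarrow> ('b, 'n) monoid_scheme \<Rightarrow> (('b \<Rightarrow> 'a) \<times> 'b) monoid"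
  where "wreath_product A B = (let D = sum_group (carrier B) (\<lambda>_. A) in
    \<lparr>carrier = carrier D \<times> carrier B,
     monoid.mult = (\<lambda>(f, b) (f', b'). (f \<otimes>\<^bsub>D\<^esub> wreath_shift B b f', b \<otimes>\<^bsub>B\<^esub> b')),
     one = (\<one>\<^bsub>D\<^esub>, \<one>\<^bsub>B\<^esub>)\<rparr>)"

definition wreath_embed_base ::
    "('a, 'm) monoid_scheme \<Rightarrow> ('b, 'n) monoid_scheme \<Rightarrow> 'a \<Rightarrow> ('b \<Rightarrow> 'a) \<times> 'b"
  where "wreath_embed_base A B a =
    ((\<lambda>x\<in>carrier B. if x = \<one>\<^bsub>B\<^esub> then a else \<one>\<^bsub>A\<^esub>), \<one>\<^bsub>B\<^esub>)"

definition wreath_embed_top ::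
    "('a, 'm) monoid_scheme \<Rightarrow> ('b, 'n) monoid_scheme \<Rightarrow> 'b \<Rightarrow> ('b \<Rightarrow> 'a) \<times> 'b"
  where "wreath_embed_top A B b = ((\<lambda>x\<in>carrier B. \<one>\<^bsub>A\<^esub>), b)"

definition wreath_standard_gens ::
    "('a, 'm) monoid_scheme \<Rightarrow> ('b, 'n) monoid_scheme \<Rightarrow> 'a set \<Rightarrow> 'b set \<Rightarrow> (('b \<Rightarrow> 'a) \<times> 'b) set"
  where "wreath_standard_gens A B S\<^sub>A S\<^sub>B =
    wreath_embed_base A B ` S\<^sub>A \<union> wreath_embed_top A B ` S\<^sub>B"

end

theory Submission
  imports Defs
begin

text \<open>An element \<open>(f, b)\<close> of the wreath product has length \<open>\<Sum>\<^sub>x |f x| + K (supp f) b\<close>, where \<open>K F b\<close>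
  is the least length of a walk in the Cayley graph of \<open>B\<close> that starts at the identity, visits \<open>F\<close>
  and ends at \<open>b\<close>. Let \<open>g \<noteq> 1\<close> be a dead end of \<open>A\<close> of depth at least \<open>n\<close>, and let \<open>f\<close> be \<open>g\<close> on a
  finite set \<open>F\<close> that contains the ball of radius \<open>n\<close> around \<open>b\<close>. A word of length \<open>n\<close> cannot
  increase any \<open>|f x|\<close> and cannot leave \<open>F\<close>, so \<open>(f, b)\<close> is a dead end of depth at least \<open>n\<close>
  whenever \<open>K F\<close> restricted to the ball attains its maximum at \<open>b\<close>.

  If the values of \<open>K F\<close> on \<open>F\<close> exceed its value at some point by at most \<open>C\<close>, and \<open>F\<close> contains
  the ball of radius \<open>(C + 1) n\<close> around that point, then moving at most \<open>C\<close> times to a larger value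
  within distance \<open>n\<close> leads to such a \<open>b\<close>. For finite \<open>B\<close> one takes \<open>F = B\<close>. If some generator
  \<open>t\<close> of infinite order generates a proper subgroup, then \<open>F\<close> can be chosen to contain a spanning
  two-dimensional grid, whose nearly Hamiltonian paths give \<open>C = 2\<close>. Otherwise the Cayley graph is
  a line, possibly with loops, and \<open>F = {t\<^sup>-\<^sup>n, \<dots>, t\<^sup>n}\<close> with \<open>b = 1\<close> works.\<close>

section \<open>Walks and grids\<close>

text \<open>Walks are recorded by their vertices, so \<open>k\<close> steps give a list of length
  \<open>k + 1\<close>. This shift accounts for the \<open>Suc\<close> in the length estimates
  below.\<close>

definition walk :: "('v \<Rightarrow> 'v \<Rightarrow> bool) \<Rightarrow> 'v \<Rightarrow> 'v list \<Rightarrow> 'v \<Rightarrow> bool"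
  where "walk E p vs q \<longleftrightarrow> vs \<noteq> [] \<and> hd vs = p \<and> last vs = q \<and> successively E vs"

lemma walk_singleton [simp]: "walk E p [p] p"
  by (simp add: walk_def)

lemma walk_append:
  assumes "walk E p us q" "E q r" "walk E r vs z"
  shows "walk E p (us @ vs) z"
  using assms by (auto simp: walk_def successively_append_iff)

lemma walk_snoc: "walk E p us q \<Longrightarrow> E q r \<Longrightarrow> walk E p (us @ [r]) r"
  by (rule walk_append) auto

lemma walk_Cons: "E p r \<Longrightarrow> walk E r vs q \<Longrightarrow> walk E p (p # vs) q"
  using walk_append[of E p "[p]" p r vs q] by simp

lemma walk_map:
  assumes "walk E p vs q"
    and "\<And>x y. x \<in> set vs \<Longrightarrow> y \<in> set vs \<Longrightarrow> E x y \<Longrightarrow> E' (f x) (f y)"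
  shows "walk E' (f p) (map f vs) (f q)"
proof -
  have "successively (\<lambda>x y. E' (f x) (f y)) vs"
  proof (rule successively_mono)
    show "successively E vs" using assms(1) by (simp add: walk_def)
  qed (fact assms(2))
  then show ?thesis
    using assms(1) by (auto simp: walk_def successively_map hd_map last_map)
qed

lemma walk_rev:
  assumes "walk E p vs q" "\<And>x y. x \<in> set vs \<Longrightarrow> y \<in> set vs \<Longrightarrow> E x y \<Longrightarrow> E y x"
  shows "walk E q (rev vs) p"
proof -
  have "successively (\<lambda>x y. E y x) vs"
  proof (rule successively_mono)
    show "successively E vs" using assms(1) by (simp add: walk_def)
  qed (fact assms(2))
  then show ?thesis
    using assms(1) by (auto simp: walk_def successively_rev hd_rev last_rev)
qed

lemma walk_upt:
  assumes "\<And>i. i < n \<Longrightarrow> E (f i) (f (Suc i))"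
  shows "walk E (f 0) (map f [0..<Suc n]) (f n)"
  using assms
proof (induction n)
  case (Suc n)
  then have "walk E (f 0) (map f [0..<Suc n] @ [f (Suc n)]) (f (Suc n))"
    by (intro walk_snoc) auto
  then show ?case by simp
qed simp

text \<open>Unlike in \<open>walk_append\<close>, the two walks share the vertex \<open>q\<close>;
  it is kept once, whence the \<open>- 1\<close>.\<close>

lemma walk_join:
  assumes "walk E p us q" "walk E q vs r"
  obtains ws where "walk E p ws r" "set ws = set us \<union> set vs" "length ws = length us + length vs - 1"
proof (cases "tl vs")
  case Nil
  then have "vs = [q]" "r = q" using assms(2) by (cases vs; auto simp: walk_def)+
  moreover have "q \<in> set us" using assms(1) unfolding walk_def by auto
  ultimately show thesis using assms(1) by (intro that[of us]) auto
next
  case (Cons v vs')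
  then have vs: "vs = q # v # vs'" using assms(2) by (cases vs) (auto simp: walk_def)
  then have "E q v" "walk E v (v # vs') r" using assms(2) by (auto simp: walk_def)
  moreover have "q \<in> set us" using assms(1) unfolding walk_def by auto
  ultimately show thesis using walk_append[OF assms(1)] vs
    by (intro that[of "us @ v # vs'"]) auto
qed

text \<open>Unit speed: changing the value by \<open>d\<close> takes at least \<open>d\<close>
  steps. This yields the lower bound for tours of a segment of the line.\<close>

lemma successively_int_diff_le:
  assumes "successively (\<lambda>x y. \<bar>x - y\<bar> \<le> 1) es" "i \<le> j" "j < length es"
  shows "\<bar>es ! j - es ! i\<bar> \<le> int (j - i)"
  using assms(2,3)
proof (induction j rule: dec_induct)
  case (step k)
  then have "\<bar>es ! k - es ! Suc k\<bar> \<le> 1" "\<bar>es ! k - es ! i\<bar> \<le> int (k - i)"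
    using assms(1) by (auto simp: successively_conv_nth)
  then show ?case using step.hyps by (simp add: Suc_diff_le)
qed simp

section \<open>Nearly Hamiltonian paths in grids with an even number of rows\<close>

definition grid_adj :: "nat \<times> nat \<Rightarrow> nat \<times> nat \<Rightarrow> bool"
  where "grid_adj p q \<longleftrightarrow>
    fst p = fst q \<and> (snd q = Suc (snd p) \<or> snd p = Suc (snd q)) \<or>
    snd p = snd q \<and> (fst q = Suc (fst p) \<or> fst p = Suc (fst q))"

lemma grid_adj_sym: "grid_adj p q \<Longrightarrow> grid_adj q p"
  by (auto simp: grid_adj_def)

definition grid_tour :: "nat \<times> nat \<Rightarrow> (nat \<times> nat) set \<Rightarrow> nat \<times> nat \<Rightarrow> nat \<Rightarrow> bool"
  where "grid_tour p V q n \<longleftrightarrow> (\<exists>vs. walk grid_adj p vs q \<and> set vs = V \<and> length vs = n)"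

lemma grid_tour_singleton: "grid_tour p {p} p 1"
  unfolding grid_tour_def by (intro exI[of _ "[p]"]) auto

lemma grid_tour_append:
  assumes "grid_tour p U q m" "grid_adj q r" "grid_tour r V z n"
  shows "grid_tour p (U \<union> V) z (m + n)"
proof -
  obtain us vs where "walk grid_adj p us q" "set us = U" "length us = m"
    "walk grid_adj r vs z" "set vs = V" "length vs = n"
    using assms unfolding grid_tour_def by blast
  then show ?thesis
    using walk_append[of grid_adj p us q r vs z] assms(2)
    unfolding grid_tour_def by (intro exI[of _ "us @ vs"]) auto
qed

lemma grid_tour_map:
  assumes "grid_tour p V q n" "\<And>x y. x \<in> V \<Longrightarrow> y \<in> V \<Longrightarrow> grid_adj x y \<Longrightarrow> grid_adj (f x) (f y)"
  shows "grid_tour (f p) (f ` V) (f q) n"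
proof -
  obtain vs where "walk grid_adj p vs q" "set vs = V" "length vs = n"
    using assms(1) unfolding grid_tour_def by blast
  then show ?thesis
    using walk_map[of grid_adj p vs q grid_adj f] assms(2)
    unfolding grid_tour_def by (intro exI[of _ "map f vs"]) auto
qed

lemma grid_tour_rev:
  assumes "grid_tour p V q n"
  shows "grid_tour q V p n"
proof -
  obtain vs where "walk grid_adj p vs q" "set vs = V" "length vs = n"
    using assms unfolding grid_tour_def by blast
  then show ?thesis
    using walk_rev[of grid_adj p vs q] grid_adj_sym
    unfolding grid_tour_def by (intro exI[of _ "rev vs"]) auto
qed

lemma grid_tour_row:
  assumes "x \<le> x'"
  shows "grid_tour (x, y) ({x..x'} \<times> {y}) (x', y) (Suc x' - x)"
proof -
  let ?f = "\<lambda>i. (x + i, y)"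
  have "walk grid_adj (?f 0) (map ?f [0..<Suc (x' - x)]) (?f (x' - x))"
    by (rule walk_upt) (simp add: grid_adj_def)
  moreover have "set (map ?f [0..<Suc (x' - x)]) = {x..x'} \<times> {y}"
  proof -
    have "(i, y) \<in> ?f ` {0..<Suc (x' - x)}" if "x \<le> i" "i \<le> x'" for i
      using that by (intro image_eqI[of _ _ "i - x"]) auto
    then have "{x..x'} \<times> {y} \<subseteq> ?f ` {0..<Suc (x' - x)}" by (auto simp del: atLeastLessThanSuc)
    moreover have "?f ` {0..<Suc (x' - x)} \<subseteq> {x..x'} \<times> {y}" using assms by auto
    ultimately show ?thesis by (simp only: set_map set_upt)
  qed
  ultimately show ?thesis
    using assms unfolding grid_tour_def by (intro exI[of _ "map ?f [0..<Suc (x' - x)]"]) auto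
qed

lemma grid_tour_column: "grid_tour (x, 0) ({x} \<times> {..n}) (x, n) (Suc n)"
proof -
  have "walk grid_adj (x, 0) (map (Pair x) [0..<Suc n]) (x, n)"
    by (rule walk_upt) (simp add: grid_adj_def)
  then show ?thesis
    unfolding grid_tour_def by (intro exI[of _ "map (Pair x) [0..<Suc n]"]) auto
qed

text \<open>Out along row 0, one step up, back along row 1. The rows may begin in different columns
  because \<open>grid_cycle\<close> has to leave out the corner.\<close>

lemma grid_tour_two_rows:
  assumes "x \<le> x'" "x'' \<le> x'"
  shows "grid_tour (x, 0) ({x..x'} \<times> {0} \<union> {x''..x'} \<times> {1}) (x'', 1) (Suc x' - x + (Suc x' - x''))"
  using grid_tour_append[OF grid_tour_row[OF assms(1), of 0] _ grid_tour_rev[OF grid_tour_row[OF assms(2), of 1]]]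
  by (simp add: grid_adj_def)

lemma grid_tour_shift_rows:
  assumes "grid_tour (x, 0) V (x', y') n"
  shows "grid_tour (x, 2) ((\<lambda>(i, j). (i, j + 2)) ` V) (x', y' + 2) n"
proof -
  let ?s = "\<lambda>(i, j). (i, j + 2) :: nat \<times> nat"
  have "grid_adj (?s p) (?s q)" if "grid_adj p q" for p q
    using that by (cases p; cases q) (auto simp: grid_adj_def)
  then have "grid_tour (?s (x, 0)) (?s ` V) (?s (x', y')) n"
    by (rule grid_tour_map[OF assms])
  then show ?thesis by (simp add: numeral_2_eq_2)
qed

text \<open>A Hamiltonian cycle through the edge from \<open>(0, 0)\<close> to \<open>(0, 1)\<close>, with the vertex \<open>(0, 0)\<close>
  removed so that the induction adds two rows at a time.\<close>

lemma grid_cycle: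
  assumes "a \<ge> 2" "b > 0"
  shows "grid_tour (1, 0) ({..<a} \<times> {..<2 * b} - {(0, 0)}) (0, 1) (a * (2 * b) - 1)"
  using assms(2)
proof (induction b rule: nat_induct_non_zero)
  case 1
  have "{1..a - 1} \<times> {0} \<union> {0..a - 1} \<times> {1} = {..<a} \<times> {..<2 * 1} - {(0, 0::nat)}"
    using assms(1) by (auto simp: less_2_cases_iff)
  then show ?case
    using grid_tour_two_rows[of 1 "a - 1" 0] assms(1) by (simp add: algebra_simps)
next
  case (Suc b)
  let ?s = "\<lambda>(i, j). (i, j + 2) :: nat \<times> nat"
  let ?V = "{..<a} \<times> {..<2 * b} - {(0, 0)}"
  \<comment> \<open>The path covers rows 0 and 1 except for column 0, enters the shifted smaller
    path at \<open>(1, 2)\<close>, leaves it at \<open>(0, 3)\<close> and descends through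
    \<open>(0, 2)\<close>, the shift of the missing corner, to \<open>(0, 1)\<close>.\<close>
  have 1: "grid_tour (1, 0) ({1..a - 1} \<times> {0} \<union> {1..a - 1} \<times> {1}) (1, 1) (2 * (a - 1))"
    using grid_tour_two_rows[of 1 "a - 1" 1] assms(1) by (simp add: mult_2)
  have 2: "grid_tour (1, 2) (?s ` ?V) (0, 3) (a * (2 * b) - 1)"
    using grid_tour_shift_rows[OF Suc.IH] by (simp add: eval_nat_numeral)
  have 3: "grid_tour (0, 2) ({(0, 2)} \<union> {(0, 1)}) (0, 1) (1 + 1)"
    by (intro grid_tour_append[OF grid_tour_singleton _ grid_tour_singleton]) (simp add: grid_adj_def)
  have 4: "grid_tour (1, 0) (({1..a - 1} \<times> {0} \<union> {1..a - 1} \<times> {1}) \<union> (?s ` ?V \<union> ({(0, 2)} \<union> {(0, 1)})))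
      (0, 1) (2 * (a - 1) + (a * (2 * b) - 1 + (1 + 1)))"
    by (intro grid_tour_append[OF 1 _ grid_tour_append[OF 2 _ 3]]) (simp_all add: grid_adj_def)
  have "({1..a - 1} \<times> {0} \<union> {1..a - 1} \<times> {1}) \<union> (?s ` ?V \<union> ({(0, 2)} \<union> {(0, 1)}))
      = {..<a} \<times> {..<2 * Suc b} - {(0, 0)}" (is "?L = ?R")
  proof (intro equalityI subsetI)
    fix p assume "p \<in> ?L" then show "p \<in> ?R" using assms(1) Suc.hyps by auto
  next
    fix p assume p: "p \<in> ?R"
    obtain i j where ij: "p = (i, j)" by force
    show "p \<in> ?L"
    proof (cases "j < 2")
      case True
      then show ?thesis using p ij by (auto simp: less_2_cases_iff)
    next
      case False
      then obtain k where k: "j = k + 2" by (metis add.commute le_Suc_ex not_less)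
      show ?thesis
      proof (cases "i = 0 \<and> k = 0")
        case False
        then have "(i, k) \<in> ?V" using p ij k by auto
        then have "?s (i, k) \<in> ?s ` ?V" by (rule imageI)
        then show ?thesis using ij k by simp
      qed (use ij k in auto)
    qed
  qed
  moreover have "2 * (a - 1) + (a * (2 * b) - 1 + (1 + 1)) = a * (2 * Suc b) - 1"
  proof -
    have "a * (2 * b) \<ge> 1" using assms(1) Suc.hyps by (simp add: Suc_le_eq)
    then show ?thesis using assms(1) by (simp add: algebra_simps)
  qed
  ultimately show ?case using 4 by simp
qed

text \<open>If the target lies in the two lowest rows, follow the Hamiltonian cycle, up to
  \<open>(0, 1)\<close> or all the way around. Otherwise sweep these two rows, arriving at
  \<open>(0, 1)\<close>, and continue by induction in the grid above them.\<close>

lemma grid_tour_first_column: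
  assumes "a \<ge> 2" "y < 2 * b"
  shows "\<exists>n \<le> a * (2 * b) + 1. grid_tour (0, 0) ({..<a} \<times> {..<2 * b}) (0, y) n"
  using assms(2)
proof (induction b arbitrary: y)
  case (Suc b)
  show ?case
  proof (cases "y < 2")
    case True
    let ?V = "{..<a} \<times> {..<2 * Suc b}" and ?n = "1 + (a * (2 * Suc b) - 1)"
    have "grid_tour (0, 0) ({(0, 0)} \<union> (?V - {(0, 0)})) (0, 1) ?n"
      by (intro grid_tour_append[OF grid_tour_singleton _ grid_cycle[OF assms(1)]])
         (simp_all add: grid_adj_def)
    moreover have "{(0, 0)} \<union> (?V - {(0, 0)}) = ?V" using assms(1) by auto
    ultimately have 1: "grid_tour (0, 0) ?V (0, 1) ?n" by (simp only:)
    have "grid_tour (0, 0) (?V \<union> {(0, 0)}) (0, 0) (?n + 1)"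
      by (rule grid_tour_append[OF 1 _ grid_tour_singleton]) (simp add: grid_adj_def)
    moreover have "?V \<union> {(0, 0)} = ?V" using assms(1) by auto
    ultimately have "grid_tour (0, 0) ?V (0, 0) (?n + 1)" by (simp only:)
    moreover have "?n + 1 \<le> a * (2 * Suc b) + 1" using assms(1) by simp
    moreover have "?n \<le> a * (2 * Suc b) + 1" by simp
    moreover have "y = 0 \<or> y = 1" using True by auto
    ultimately show ?thesis using 1 by blast
  next
    case False
    let ?s = "\<lambda>(i, j). (i, j + 2) :: nat \<times> nat"
    let ?V = "{..<a} \<times> {..<2 * b}"
    from False Suc.prems have "y - 2 < 2 * b" by simp
    from Suc.IH[OF this] obtain n where
      n: "n \<le> a * (2 * b) + 1" "grid_tour (0, 0) ?V (0, y - 2) n" by blast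
    have "y - 2 + 2 = y" using False by simp
    then have 2: "grid_tour (0, 2) (?s ` ?V) (0, y) n"
      using grid_tour_shift_rows[OF n(2)] by metis
    have 1: "grid_tour (0, 0) ({0..a - 1} \<times> {0} \<union> {0..a - 1} \<times> {1}) (0, 1) (2 * a)"
      using grid_tour_two_rows[of 0 "a - 1" 0] assms(1) by (simp add: mult_2)
    have "grid_tour (0, 0) (({0..a - 1} \<times> {0} \<union> {0..a - 1} \<times> {1}) \<union> ?s ` ?V) (0, y) (2 * a + n)"
      by (intro grid_tour_append[OF 1 _ 2]) (simp add: grid_adj_def)
    moreover have "({0..a - 1} \<times> {0} \<union> {0..a - 1} \<times> {1}) \<union> ?s ` ?V = {..<a} \<times> {..<2 * Suc b}"
      (is "?L = ?R")
    proof (intro equalityI subsetI)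
      fix p assume "p \<in> ?L" then show "p \<in> ?R" using assms(1) by auto
    next
      fix p assume p: "p \<in> ?R"
      obtain i j where ij: "p = (i, j)" by force
      show "p \<in> ?L"
      proof (cases "j < 2")
        case True
        then show ?thesis using p ij by (auto simp: less_2_cases_iff)
      next
        case False
        then have "(i, j - 2) \<in> ?V" using p ij by auto
        then have "?s (i, j - 2) \<in> ?s ` ?V" by (rule imageI)
        moreover have "?s (i, j - 2) = p" using ij False by simp
        ultimately show ?thesis by simp
      qed
    qed
    moreover have "2 * a + n \<le> a * (2 * Suc b) + 1" using n(1) by simp
    ultimately show ?thesis by (intro exI[of _ "2 * a + n"]) (simp only: simp_thms)
  qed
qed simp

text \<open>Climb column 0 and continue by induction in the remaining columns, which are entered at
  their top corner. The strict bound on \<open>x\<close> leaves at least two columns when the target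
  has become the first one, as the cycle requires.\<close>

lemma grid_tour_not_last_column:
  assumes "Suc x < a" "y < 2 * b"
  shows "\<exists>n \<le> a * (2 * b) + 1. grid_tour (0, 0) ({..<a} \<times> {..<2 * b}) (x, y) n"
  using assms
proof (induction x arbitrary: a y)
  case 0
  then show ?case using grid_tour_first_column by simp
next
  case (Suc x)
  \<comment> \<open>Turning the smaller grid upside down sends its starting corner to
    \<open>(1, 2 * b - 1)\<close>, next to the top of column 0.\<close>
  let ?s = "\<lambda>(i, j). (Suc i, 2 * b - 1 - j) :: nat \<times> nat"
  let ?V = "{..<a - 1} \<times> {..<2 * b}"
  have "Suc x < a - 1" "2 * b - 1 - y < 2 * b" using Suc.prems by auto
  from Suc.IH[OF this] obtain n where
    n: "n \<le> (a - 1) * (2 * b) + 1" "grid_tour (0, 0) ?V (x, 2 * b - 1 - y) n" by blast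
  have "grid_adj (?s p) (?s q)" if "p \<in> ?V" "q \<in> ?V" "grid_adj p q" for p q
    using that by (cases p; cases q) (auto simp: grid_adj_def)
  then have "grid_tour (?s (0, 0)) (?s ` ?V) (?s (x, 2 * b - 1 - y)) n"
    by (rule grid_tour_map[OF n(2)])
  moreover have "?s (0, 0) = (1, 2 * b - 1)" "?s (x, 2 * b - 1 - y) = (Suc x, y)"
    using Suc.prems by auto
  ultimately have 2: "grid_tour (1, 2 * b - 1) (?s ` ?V) (Suc x, y) n"
    by (simp only:)
  have "grid_tour (0, 0) ({0} \<times> {..2 * b - 1} \<union> ?s ` ?V) (Suc x, y) (Suc (2 * b - 1) + n)"
    by (intro grid_tour_append[OF grid_tour_column _ 2]) (simp add: grid_adj_def)
  moreover have "{0} \<times> {..2 * b - 1} \<union> ?s ` ?V = {..<a} \<times> {..<2 * b}" (is "?L = ?R")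
  proof (intro equalityI subsetI)
    fix p assume "p \<in> ?L" then show "p \<in> ?R" using Suc.prems by auto
  next
    fix p assume p: "p \<in> ?R"
    obtain i j where ij: "p = (i, j)" by force
    show "p \<in> ?L"
    proof (cases i)
      case (Suc k)
      then have "(k, 2 * b - 1 - j) \<in> ?V" using p ij by auto
      then have "?s (k, 2 * b - 1 - j) \<in> ?s ` ?V" by (rule imageI)
      then show ?thesis using ij p Suc by auto
    qed (use p ij in auto)
  qed
  moreover have "Suc (2 * b - 1) + n \<le> a * (2 * b) + 1"
  proof -
    have "a * (2 * b) = (a - 1) * (2 * b) + 2 * b" using Suc.prems by (cases a) auto
    then show ?thesis using n(1) Suc.prems by linarith
  qed
  ultimately show ?case by (intro exI[of _ "Suc (2 * b - 1) + n"]) (simp only: simp_thms)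
qed

lemma grid_tour_even:
  assumes "a \<ge> 2" "x < a" "y < 2 * b"
  shows "\<exists>n \<le> a * (2 * b) + 2. grid_tour (0, 0) ({..<a} \<times> {..<2 * b}) (x, y) n"
proof (cases "Suc x < a")
  case True
  from grid_tour_not_last_column[OF this assms(3)] obtain n where
    "n \<le> a * (2 * b) + 1" "grid_tour (0, 0) ({..<a} \<times> {..<2 * b}) (x, y) n" by blast
  then show ?thesis by (intro exI[of _ n]) simp
next
  case False
  then have "Suc (x - 1) < a" using assms by simp
  from grid_tour_not_last_column[OF this assms(3)] obtain n where
    n: "n \<le> a * (2 * b) + 1" "grid_tour (0, 0) ({..<a} \<times> {..<2 * b}) (x - 1, y) n" by blast
  have "grid_tour (0, 0) ({..<a} \<times> {..<2 * b} \<union> {(x, y)}) (x, y) (n + 1)"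
    using n(2) by (rule grid_tour_append[OF _ _ grid_tour_singleton]) (use False assms in \<open>auto simp: grid_adj_def\<close>)
  moreover have "{..<a} \<times> {..<2 * b} \<union> {(x, y)} = {..<a} \<times> {..<2 * b}" using assms by auto
  moreover have "n + 1 \<le> a * (2 * b) + 2" using n(1) by simp
  ultimately show ?thesis by (intro exI[of _ "n + 1"]) (simp only: simp_thms)
qed


section \<open>Word length in wreath products\<close>

lemma word_prod_Nil [simp]: "word_prod G [] = \<one>\<^bsub>G\<^esub>"
  and word_prod_Cons [simp]: "word_prod G (w # ws) = w \<otimes>\<^bsub>G\<^esub> word_prod G ws"
  by (simp_all add: word_prod_def)

lemma (in monoid) word_prod_closed [intro]:
  "ws \<in> lists (carrier G) \<Longrightarrow> word_prod G ws \<in> carrier G"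
  by (induction ws) auto

lemma (in monoid) word_prod_append:
  assumes "us \<in> lists (carrier G)" "vs \<in> lists (carrier G)"
  shows "word_prod G (us @ vs) = word_prod G us \<otimes> word_prod G vs"
  using assms(1) by (induction us) (use assms(2) word_prod_closed in \<open>auto simp: m_assoc\<close>)

lemma (in monoid) word_prod_snoc:
  assumes "us \<in> lists (carrier G)" "s \<in> carrier G"
  shows "word_prod G (us @ [s]) = word_prod G us \<otimes> s"
  using assms word_prod_append[of us "[s]"] by simp

lemma (in group) generate_word:
  assumes "S \<subseteq> carrier G" "\<And>s. s \<in> S \<Longrightarrow> inv s \<in> S" "g \<in> generate G S"
  shows "\<exists>ws\<in>lists S. word_prod G ws = g"
  using assms(3)
proof induction
  case one
  then show ?case by (intro bexI[of _ "[]"]) auto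
next
  case (incl h)
  then show ?case using assms(1) by (intro bexI[of _ "[h]"]) auto
next
  case (inv h)
  then show ?case using assms(1,2) by (intro bexI[of _ "[inv h]"]) auto
next
  case (eng h1 h2)
  then obtain us vs where "us \<in> lists S" "word_prod G us = h1" "vs \<in> lists S" "word_prod G vs = h2"
    by blast
  then show ?case
    using word_prod_append[of us vs] assms(1) lists_mono[OF assms(1)]
    by (intro bexI[of _ "us @ vs"]) auto
qed

lemma word_length_le: "ws \<in> lists S \<Longrightarrow> word_prod G ws = g \<Longrightarrow> word_length G S g \<le> length ws"
  unfolding word_length_def by (rule Least_le) blast

lemma word_length_witness:
  assumes "\<exists>ws\<in>lists S. word_prod G ws = g"
  obtains ws where "ws \<in> lists S" "word_prod G ws = g" "length ws = word_length G S g"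
proof -
  have "\<exists>n. \<exists>ws\<in>lists S. length ws = n \<and> word_prod G ws = g"
    using assms by blast
  from LeastI_ex[OF this] show thesis
    using that unfolding word_length_def by blast
qed

lemma word_length_one [simp]: "word_length G S \<one>\<^bsub>G\<^esub> = 0"
  using word_length_le[of "[]" S G] by simp

lemma (in group) word_length_mult_gen:
  assumes "S \<subseteq> carrier G" "\<exists>ws\<in>lists S. word_prod G ws = g" "s \<in> S"
  shows "word_length G S (g \<otimes> s) \<le> Suc (word_length G S g)"
proof -
  obtain ws where ws: "ws \<in> lists S" "word_prod G ws = g" "length ws = word_length G S g"
    using word_length_witness[OF assms(2)] .
  then have "ws @ [s] \<in> lists S" "word_prod G (ws @ [s]) = g \<otimes> s"
    using assms lists_mono[OF assms(1)] by (auto intro: word_prod_snoc)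
  from word_length_le[OF this] show ?thesis using ws(3) by simp
qed

section \<open>Cayley balls and a reformulation of unbounded depth\<close>

text \<open>Described by words instead of by \<open>word_length\<close>, so that it matches the
  quantification over words in \<open>dead_end_depth\<close>.\<close>

definition cayley_ball :: "('a, 'm) monoid_scheme \<Rightarrow> 'a set \<Rightarrow> 'a \<Rightarrow> nat \<Rightarrow> 'a set"
  where "cayley_ball G S g n = {g \<otimes>\<^bsub>G\<^esub> word_prod G ws |ws. ws \<in> lists S \<and> length ws \<le> n}"

lemma cayley_ball_mono: "m \<le> n \<Longrightarrow> cayley_ball G S g m \<subseteq> cayley_ball G S g n"
  unfolding cayley_ball_def by force

lemma (in monoid) cayley_ball_center: "g \<in> carrier G \<Longrightarrow> g \<in> cayley_ball G S g n"
  unfolding cayley_ball_def by (auto intro!: exI[of _ "[]"])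

lemma (in monoid) cayley_ball_subset_carrier:
  assumes "S \<subseteq> carrier G" "g \<in> carrier G"
  shows "cayley_ball G S g n \<subseteq> carrier G"
  using assms lists_mono[OF assms(1)] unfolding cayley_ball_def by blast

lemma (in monoid) cayley_ball_trans:
  assumes "S \<subseteq> carrier G" "g \<in> carrier G" "h \<in> cayley_ball G S g m" "k \<in> cayley_ball G S h n"
  shows "k \<in> cayley_ball G S g (m + n)"
proof -
  obtain us vs where "us \<in> lists S" "length us \<le> m" "h = g \<otimes> word_prod G us"
    and "vs \<in> lists S" "length vs \<le> n" "k = h \<otimes> word_prod G vs"
    using assms(3,4) unfolding cayley_ball_def by blast
  moreover from this have "us \<in> lists (carrier G)" "vs \<in> lists (carrier G)"
    using lists_mono[OF assms(1)] by auto
  then have "k = g \<otimes> word_prod G (us @ vs)"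
    using calculation assms(2) word_prod_closed by (simp only: word_prod_append m_assoc)
  ultimately show ?thesis
    unfolding cayley_ball_def by (intro CollectI exI[of _ "us @ vs"]) auto
qed

lemma (in monoid) cayley_ball_step:
  assumes "S \<subseteq> carrier G" "g \<in> carrier G" "h \<in> cayley_ball G S g n" "s \<in> S"
  shows "h \<otimes> s \<in> cayley_ball G S g (Suc n)"
proof -
  have "h \<otimes> s \<in> cayley_ball G S h 1"
    using assms(1,4) unfolding cayley_ball_def by (auto intro!: exI[of _ "[s]"])
  from cayley_ball_trans[OF assms(1-3) this] show ?thesis by simp
qed

lemma finite_cayley_ball:
  assumes "finite S"
  shows "finite (cayley_ball G S g n)"
proof -
  have "cayley_ball G S g n = (\<lambda>ws. g \<otimes>\<^bsub>G\<^esub> word_prod G ws) ` {ws. set ws \<subseteq> S \<and> length ws \<le> n}"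
    unfolding cayley_ball_def by (auto simp: lists_eq_set)
  then show ?thesis using finite_lists_length_le[OF assms] by simp
qed

text \<open>If \<open>n\<close> were missing, downward closure would bound \<open>D\<close> by
  \<open>n - 1\<close>, and the supremum could not reach \<open>n\<close>. This covers finite and
  infinite depth at once.\<close>

lemma enat_le_Sup_iff:
  assumes "n \<ge> 1" "\<And>m. m \<in> D \<Longrightarrow> n \<le> m \<Longrightarrow> n \<in> D"
  shows "enat n \<le> Sup (enat ` D) \<longleftrightarrow> n \<in> D"
proof
  assume le: "enat n \<le> Sup (enat ` D)"
  show "n \<in> D"
  proof (rule ccontr)
    assume "n \<notin> D"
    then have "m \<le> n - 1" if "m \<in> D" for m
      using assms(2)[OF that] by linarith
    then have "Sup (enat ` D) \<le> enat (n - 1)"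
      by (intro Sup_least) auto
    with le have "enat n \<le> enat (n - 1)" by (rule order_trans)
    then show False using assms(1) by simp
  qed
qed (auto intro: Sup_upper)

lemma le_dead_end_depth_iff:
  assumes "n \<ge> 1"
  shows "enat n \<le> dead_end_depth G S g \<longleftrightarrow>
    (\<forall>h\<in>cayley_ball G S g n. word_length G S h \<le> word_length G S g)"
proof -
  let ?D = "{n. 1 \<le> n \<and> (\<forall>k\<le>n. \<forall>ws\<in>lists S. length ws = k \<longrightarrow>
        word_length G S (g \<otimes>\<^bsub>G\<^esub> word_prod G ws) \<le> word_length G S g)}"
  have "n \<in> ?D" if "m \<in> ?D" "n \<le> m" for m
    using that assms le_trans by (simp only: mem_Collect_eq) meson
  then have "enat n \<le> Sup (enat ` ?D) \<longleftrightarrow> n \<in> ?D"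
    by (rule enat_le_Sup_iff[OF assms])
  then show ?thesis
    using assms unfolding dead_end_depth_def cayley_ball_def by auto
qed

text \<open>A maximum of the length on a ball of positive radius is automatically a dead end.
  Passing to radius \<open>Suc n\<close> keeps the radius positive when
  \<open>n = 0\<close>.\<close>

lemma (in monoid) unbounded_depth_iff:
  assumes "S \<subseteq> carrier G"
  shows "unbounded_depth G S \<longleftrightarrow>
    (\<forall>n. \<exists>g\<in>carrier G. \<forall>h\<in>cayley_ball G S g n. word_length G S h \<le> word_length G S g)"
    (is "_ \<longleftrightarrow> (\<forall>n. \<exists>g\<in>carrier G. ?P n g)")
proof
  assume u: "unbounded_depth G S"
  show "\<forall>n. \<exists>g\<in>carrier G. ?P n g"
  proof
    fix n
    obtain g where g: "dead_end G S g" "enat (Suc n) \<le> dead_end_depth G S g"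
      using u unfolding unbounded_depth_def by blast
    then have "?P (Suc n) g" by (simp add: le_dead_end_depth_iff)
    then have "?P n g" using cayley_ball_mono[of n "Suc n"] by (meson le_Suc_eq order_refl subsetD)
    then show "\<exists>g\<in>carrier G. ?P n g" using g(1) unfolding dead_end_def by blast
  qed
next
  assume r: "\<forall>n. \<exists>g\<in>carrier G. ?P n g"
  show "unbounded_depth G S"
    unfolding unbounded_depth_def
  proof
    fix n
    obtain g where g: "g \<in> carrier G" "?P (Suc n) g" using r by blast
    have "g \<otimes> s \<in> cayley_ball G S g (Suc n)" if "s \<in> S" for s
      using cayley_ball_step[OF assms g(1) cayley_ball_center[OF g(1)] that] .
    then have "dead_end G S g" using g unfolding dead_end_def by blast
    moreover have "enat (Suc n) \<le> dead_end_depth G S g"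
      using g(2) by (simp add: le_dead_end_depth_iff)
    then have "enat n \<le> dead_end_depth G S g" by (rule order_trans[rotated]) simp
    ultimately show "\<exists>g. dead_end G S g \<and> enat n \<le> dead_end_depth G S g" by blast
  qed
qed

section \<open>Tours in Cayley graphs\<close>

definition cayley_adj :: "('a, 'm) monoid_scheme \<Rightarrow> 'a set \<Rightarrow> 'a \<Rightarrow> 'a \<Rightarrow> bool"
  where "cayley_adj G S x y \<longleftrightarrow> x \<in> carrier G \<and> (\<exists>s\<in>S. y = x \<otimes>\<^bsub>G\<^esub> s)"

text \<open>The route of a lamplighter: it may leave \<open>F\<close> and may repeat
  vertices.\<close>

definition cayley_tour :: "('a, 'm) monoid_scheme \<Rightarrow> 'a set \<Rightarrow> 'a set \<Rightarrow> 'a list \<Rightarrow> 'a \<Rightarrow> bool"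
  where "cayley_tour G S F vs q \<longleftrightarrow> walk (cayley_adj G S) \<one>\<^bsub>G\<^esub> vs q \<and> F \<subseteq> set vs"

text \<open>The number of vertices of a shortest tour, one more than its number of steps.\<close>

definition tour_size :: "('a, 'm) monoid_scheme \<Rightarrow> 'a set \<Rightarrow> 'a set \<Rightarrow> 'a \<Rightarrow> nat"
  where "tour_size G S F q = (LEAST n. \<exists>vs. cayley_tour G S F vs q \<and> length vs = n)"

lemma tour_size_le: "cayley_tour G S F vs q \<Longrightarrow> tour_size G S F q \<le> length vs"
  unfolding tour_size_def by (rule Least_le) blast

lemma tour_size_witness:
  assumes "\<exists>vs. cayley_tour G S F vs q"
  obtains vs where "cayley_tour G S F vs q" "length vs = tour_size G S F q"
proof -
  have "\<exists>n. \<exists>vs. cayley_tour G S F vs q \<and> length vs = n"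
    using assms by blast
  from LeastI_ex[OF this] show thesis
    using that unfolding tour_size_def by blast
qed

text \<open>Used for the effect of one letter of \<open>A\<close>, which changes a single summand by
  at most one.\<close>

lemma sum_update_le:
  fixes f g :: "'i \<Rightarrow> nat"
  assumes "finite Y" "g b \<le> f b + 1" "\<And>x. x \<noteq> b \<Longrightarrow> g x = f x"
  shows "sum g Y \<le> Suc (sum f Y)"
proof -
  have "sum g Y \<le> (\<Sum>x\<in>Y. f x + (if x = b then 1 else 0))"
    using assms(2,3) by (intro sum_mono) auto
  also have "\<dots> \<le> Suc (sum f Y)"
    using assms(1) by (auto simp: sum.distrib sum.delta)
  finally show ?thesis .
qed

section \<open>Word length in the wreath product as lamp lengths plus tour length\<close>

locale wreath_generators =
  A: group A + B: group B
  for A :: "('a, 'm) monoid_scheme" and B :: "('b, 'n) monoid_scheme" +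
  fixes S\<^sub>A :: "'a set" and S\<^sub>B :: "'b set"
  assumes S\<^sub>A: "S\<^sub>A \<subseteq> carrier A" and S\<^sub>B: "S\<^sub>B \<subseteq> carrier B"
    and word_ex: "a \<in> carrier A \<Longrightarrow> \<exists>ws\<in>lists S\<^sub>A. word_prod A ws = a"
begin

abbreviation "W \<equiv> wreath_product A B"
abbreviation "gens \<equiv> wreath_standard_gens A B S\<^sub>A S\<^sub>B"
abbreviation "supp f \<equiv> {x \<in> carrier B. f x \<noteq> \<one>\<^bsub>A\<^esub>}"
abbreviation "len\<^sub>A \<equiv> word_length A S\<^sub>A"

lemma carrier_wreath:
  "carrier W = {f \<in> carrier B \<rightarrow>\<^sub>E carrier A. finite (supp f)} \<times> carrier B"
  by (simp add: wreath_product_def Let_def carrier_sum_group)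

lemma mult_wreath:
  assumes "b \<in> carrier B"
  shows "(f, b) \<otimes>\<^bsub>W\<^esub> (f', b') = (\<lambda>x\<in>carrier B. f x \<otimes>\<^bsub>A\<^esub> f' (inv\<^bsub>B\<^esub> b \<otimes>\<^bsub>B\<^esub> x), b \<otimes>\<^bsub>B\<^esub> b')"
  using assms by (auto simp: wreath_product_def Let_def wreath_shift_def intro!: restrict_ext)

lemma one_wreath: "\<one>\<^bsub>W\<^esub> = (\<lambda>x\<in>carrier B. \<one>\<^bsub>A\<^esub>, \<one>\<^bsub>B\<^esub>)"
  by (simp add: wreath_product_def Let_def)

sublocale W: monoid W
proof
  fix g h assume "g \<in> carrier W" "h \<in> carrier W"
  then obtain f b f' b' where gh: "g = (f, b)" "h = (f', b')" "b \<in> carrier B" "b' \<in> carrier B"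
    "f \<in> carrier B \<rightarrow>\<^sub>E carrier A" "f' \<in> carrier B \<rightarrow>\<^sub>E carrier A" "finite (supp f)" "finite (supp f')"
    unfolding carrier_wreath by auto
  let ?f = "\<lambda>x\<in>carrier B. f x \<otimes>\<^bsub>A\<^esub> f' (inv\<^bsub>B\<^esub> b \<otimes>\<^bsub>B\<^esub> x)"
  \<comment> \<open>The support of a product lies in the first support united with the translate by
    \<open>b\<close> of the second, hence is finite.\<close>
  have "x \<in> supp f \<union> (\<lambda>y. b \<otimes>\<^bsub>B\<^esub> y) ` supp f'" if "x \<in> supp ?f" for x
  proof (rule ccontr)
    assume n: "x \<notin> supp f \<union> (\<lambda>y. b \<otimes>\<^bsub>B\<^esub> y) ` supp f'"
    have x: "x \<in> carrier B" using that by simp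
    then have "x = b \<otimes>\<^bsub>B\<^esub> (inv\<^bsub>B\<^esub> b \<otimes>\<^bsub>B\<^esub> x)" using gh(3) by (simp add: B.inv_solve_left' flip: B.m_assoc)
    with n have "inv\<^bsub>B\<^esub> b \<otimes>\<^bsub>B\<^esub> x \<notin> supp f'" by blast
    then show False using n that x gh(3) by simp
  qed
  then have "finite (supp ?f)"
    using gh(7,8) by (meson finite_UnI finite_imageI rev_finite_subset subsetI)
  moreover have "?f \<in> carrier B \<rightarrow>\<^sub>E carrier A" using gh(3,5,6) by (auto simp: PiE_mem)
  ultimately show "g \<otimes>\<^bsub>W\<^esub> h \<in> carrier W"
    unfolding gh(1,2) mult_wreath[OF gh(3)] carrier_wreath using gh(3,4) by simp
next
  show "\<one>\<^bsub>W\<^esub> \<in> carrier W" by (simp add: one_wreath carrier_wreath)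
next
  fix g h k assume "g \<in> carrier W" "h \<in> carrier W" "k \<in> carrier W"
  then obtain f b f' b' f'' b'' where ghk: "g = (f, b)" "h = (f', b')" "k = (f'', b'')"
    "b \<in> carrier B" "b' \<in> carrier B" "b'' \<in> carrier B"
    "f \<in> carrier B \<rightarrow>\<^sub>E carrier A" "f' \<in> carrier B \<rightarrow>\<^sub>E carrier A" "f'' \<in> carrier B \<rightarrow>\<^sub>E carrier A"
    unfolding carrier_wreath by auto
  then have "f y \<in> carrier A" "f' y \<in> carrier A" "f'' y \<in> carrier A" if "y \<in> carrier B" for y
    using that by auto
  with ghk(4-6) show "g \<otimes>\<^bsub>W\<^esub> h \<otimes>\<^bsub>W\<^esub> k = g \<otimes>\<^bsub>W\<^esub> (h \<otimes>\<^bsub>W\<^esub> k)"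
    unfolding ghk(1-3)
    by (auto simp: mult_wreath A.m_assoc B.m_assoc B.inv_mult_group intro!: restrict_ext)
next
  fix g assume "g \<in> carrier W"
  then obtain f b where g: "g = (f, b)" "b \<in> carrier B" "f \<in> carrier B \<rightarrow>\<^sub>E carrier A"
    unfolding carrier_wreath by auto
  then have "f x \<in> carrier A" if "x \<in> carrier B" for x using that by auto
  then show "\<one>\<^bsub>W\<^esub> \<otimes>\<^bsub>W\<^esub> g = g" "g \<otimes>\<^bsub>W\<^esub> \<one>\<^bsub>W\<^esub> = g"
    using g(2) PiE_restrict[OF g(3)] unfolding g(1)
    by (simp_all add: one_wreath mult_wreath cong: restrict_cong)
qed

text \<open>The lamplighter picture: right multiplication by a letter of \<open>A\<close> acts on
  the lamp at the current position \<open>b\<close>, whereas a letter of \<open>B\<close> moves the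
  position, as in \<open>mult_top\<close>.\<close>

lemma mult_base:
  assumes "(f, b) \<in> carrier W" "a \<in> carrier A"
  shows "(f, b) \<otimes>\<^bsub>W\<^esub> wreath_embed_base A B a = (f(b := f b \<otimes>\<^bsub>A\<^esub> a), b)"
proof -
  have f: "f \<in> carrier B \<rightarrow>\<^sub>E carrier A" and b: "b \<in> carrier B"
    using assms(1) by (auto simp: carrier_wreath)
  have "inv\<^bsub>B\<^esub> b \<otimes>\<^bsub>B\<^esub> x = \<one>\<^bsub>B\<^esub> \<longleftrightarrow> x = b" if "x \<in> carrier B" for x
    using that b B.inv_solve_left'[of "\<one>\<^bsub>B\<^esub>" b x] by auto
  moreover have "f x \<in> carrier A" if "x \<in> carrier B" for x
    using f that by auto
  ultimately have "(\<lambda>x\<in>carrier B. f x \<otimes>\<^bsub>A\<^esub> (\<lambda>x\<in>carrier B. if x = \<one>\<^bsub>B\<^esub> then a else \<one>\<^bsub>A\<^esub>) (inv\<^bsub>B\<^esub> b \<otimes>\<^bsub>B\<^esub> x)) x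
      = (f(b := f b \<otimes>\<^bsub>A\<^esub> a)) x" for x
    using b PiE_arb[OF f] by (cases "x \<in> carrier B") auto
  then have "(\<lambda>x\<in>carrier B. f x \<otimes>\<^bsub>A\<^esub> (\<lambda>x\<in>carrier B. if x = \<one>\<^bsub>B\<^esub> then a else \<one>\<^bsub>A\<^esub>) (inv\<^bsub>B\<^esub> b \<otimes>\<^bsub>B\<^esub> x))
      = f(b := f b \<otimes>\<^bsub>A\<^esub> a)" by (rule ext)
  then show ?thesis using b by (simp add: wreath_embed_base_def mult_wreath)
qed

lemma mult_top:
  assumes "(f, b) \<in> carrier W" "s \<in> carrier B"
  shows "(f, b) \<otimes>\<^bsub>W\<^esub> wreath_embed_top A B s = (f, b \<otimes>\<^bsub>B\<^esub> s)"
proof -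
  have f: "f \<in> carrier B \<rightarrow>\<^sub>E carrier A" and b: "b \<in> carrier B"
    using assms(1) by (auto simp: carrier_wreath)
  have "f x \<in> carrier A" if "x \<in> carrier B" for x
    using f that by auto
  then have "(\<lambda>x\<in>carrier B. f x \<otimes>\<^bsub>A\<^esub> (\<lambda>x\<in>carrier B. \<one>\<^bsub>A\<^esub>) (inv\<^bsub>B\<^esub> b \<otimes>\<^bsub>B\<^esub> x)) x = f x" for x
    using b PiE_arb[OF f] by (cases "x \<in> carrier B") auto
  then have "(\<lambda>x\<in>carrier B. f x \<otimes>\<^bsub>A\<^esub> (\<lambda>x\<in>carrier B. \<one>\<^bsub>A\<^esub>) (inv\<^bsub>B\<^esub> b \<otimes>\<^bsub>B\<^esub> x)) = f"
    by (rule ext)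
  then show ?thesis using b by (simp add: wreath_embed_top_def mult_wreath)
qed

lemma gens_carrier: "gens \<subseteq> carrier W"
proof -
  have "finite {x \<in> carrier B. x = \<one>\<^bsub>B\<^esub> \<and> P}" for P
    by (rule finite_subset[of _ "{\<one>\<^bsub>B\<^esub>}"]) auto
  then have "wreath_embed_base A B a \<in> carrier W" if "a \<in> carrier A" for a
    using that by (auto simp: wreath_embed_base_def carrier_wreath cong: conj_cong if_cong)
  moreover have "wreath_embed_top A B s \<in> carrier W" if "s \<in> carrier B" for s
    using that by (auto simp: wreath_embed_top_def carrier_wreath)
  ultimately show ?thesis
    using S\<^sub>A S\<^sub>B unfolding wreath_standard_gens_def by blast
qed

lemma gens_cases:
  assumes "s \<in> gens"
  obtains a where "a \<in> S\<^sub>A" "s = wreath_embed_base A B a"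
  | b where "b \<in> S\<^sub>B" "s = wreath_embed_top A B b"
  using assms unfolding wreath_standard_gens_def by blast

lemma base_in_gens: "a \<in> S\<^sub>A \<Longrightarrow> wreath_embed_base A B a \<in> gens"
  and top_in_gens: "b \<in> S\<^sub>B \<Longrightarrow> wreath_embed_top A B b \<in> gens"
  unfolding wreath_standard_gens_def by auto

text \<open>The positions passed while reading the word form the tour. A letter of \<open>B\<close>
  adds one vertex and a letter of \<open>A\<close> raises the sum by at most one. The estimate is
  for arbitrary \<open>Y\<close> because the support changes along the word.\<close>

lemma tour_of_word:
  assumes "ws \<in> lists gens" "word_prod W ws = (f, b)"
  shows "\<exists>vs. cayley_tour B S\<^sub>B (supp f) vs b \<and>
    (\<forall>Y. finite Y \<longrightarrow> Y \<subseteq> carrier B \<longrightarrow> length vs + (\<Sum>x\<in>Y. len\<^sub>A (f x)) \<le> Suc (length ws))"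
  using assms
proof (induction ws arbitrary: f b rule: rev_induct)
  case Nil
  then have "f = (\<lambda>x\<in>carrier B. \<one>\<^bsub>A\<^esub>)" "b = \<one>\<^bsub>B\<^esub>" by (auto simp: one_wreath)
  moreover have "(\<Sum>x\<in>Y. len\<^sub>A ((\<lambda>x\<in>carrier B. \<one>\<^bsub>A\<^esub>) x)) = 0" if "Y \<subseteq> carrier B" for Y
    using that by (intro sum.neutral) auto
  ultimately show ?case
    by (intro exI[of _ "[\<one>\<^bsub>B\<^esub>]"]) (auto simp: cayley_tour_def)
next
  case (snoc s ws)
  obtain f0 b0 where w: "word_prod W ws = (f0, b0)" by force
  have ws: "ws \<in> lists (carrier W)" and sW: "s \<in> carrier W"
    using snoc.prems(1) lists_mono[OF gens_carrier] gens_carrier by auto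
  then have fb: "(f0, b0) \<otimes>\<^bsub>W\<^esub> s = (f, b)"
    using snoc.prems(2) w W.word_prod_snoc by metis
  have c: "(f0, b0) \<in> carrier W" using W.word_prod_closed[OF ws] w by simp
  then have c': "f0 \<in> carrier B \<rightarrow>\<^sub>E carrier A" "b0 \<in> carrier B" by (auto simp: carrier_wreath)
  from snoc.IH[OF _ w] snoc.prems(1) obtain vs where
    vs: "cayley_tour B S\<^sub>B (supp f0) vs b0"
    and len: "\<And>Y. finite Y \<Longrightarrow> Y \<subseteq> carrier B \<Longrightarrow> length vs + (\<Sum>x\<in>Y. len\<^sub>A (f0 x)) \<le> Suc (length ws)"
    by auto
  from snoc.prems(1) have "s \<in> gens" by simp
  then show ?case
  proof (cases rule: gens_cases)
    case (1 a)
    then have f: "f = f0(b0 := f0 b0 \<otimes>\<^bsub>A\<^esub> a)" "b = b0"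
      using fb mult_base[OF c] S\<^sub>A by auto
    \<comment> \<open>The only lamp that changes is at the current position, the last vertex of the
      tour, so the tour still visits the whole support.\<close>
    have "b0 \<in> set vs" using vs unfolding cayley_tour_def walk_def by auto
    then have "cayley_tour B S\<^sub>B (supp f) vs b"
      using vs f unfolding cayley_tour_def by (auto split: if_splits)
    moreover have "length vs + (\<Sum>x\<in>Y. len\<^sub>A (f x)) \<le> Suc (length (ws @ [s]))"
      if "finite Y" "Y \<subseteq> carrier B" for Y
    proof -
      have "len\<^sub>A (f0 b0 \<otimes>\<^bsub>A\<^esub> a) \<le> Suc (len\<^sub>A (f0 b0))"
        using A.word_length_mult_gen[OF S\<^sub>A word_ex \<open>a \<in> S\<^sub>A\<close>] c' by (auto simp: PiE_mem)
      then have "(\<Sum>x\<in>Y. len\<^sub>A (f x)) \<le> Suc (\<Sum>x\<in>Y. len\<^sub>A (f0 x))"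
        using f that(1) by (intro sum_update_le[of _ _ b0]) auto
      then show ?thesis using len[OF that] by simp
    qed
    ultimately show ?thesis by blast
  next
    case (2 t)
    then have f: "f = f0" "b = b0 \<otimes>\<^bsub>B\<^esub> t"
      using fb mult_top[OF c] S\<^sub>B by auto
    have "cayley_adj B S\<^sub>B b0 b" using f \<open>t \<in> S\<^sub>B\<close> c' unfolding cayley_adj_def by blast
    then have "cayley_tour B S\<^sub>B (supp f) (vs @ [b]) b"
      using vs f unfolding cayley_tour_def by (auto intro: walk_snoc)
    then show ?thesis using len f by (intro exI[of _ "vs @ [b]"]) simp
  qed
qed

lemma append_base_word:
  assumes "ws \<in> lists gens" "word_prod W ws = (f, b)" "f b = \<one>\<^bsub>A\<^esub>" "as \<in> lists S\<^sub>A"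
  shows "\<exists>ws'\<in>lists gens. word_prod W ws' = (f(b := word_prod A as), b) \<and>
    length ws' = length ws + length as"
  using assms(4)
proof (induction as rule: rev_induct)
  case Nil
  have "f(b := word_prod A []) = f" using assms(3) by (simp add: fun_upd_idem)
  then show ?case using assms(1,2) by (intro bexI[of _ ws]) simp_all
next
  case (snoc a as)
  then have as: "as \<in> lists (carrier A)" "a \<in> carrier A" using S\<^sub>A lists_mono[OF S\<^sub>A] by auto
  have "as \<in> lists S\<^sub>A" using snoc.prems by simp
  from snoc.IH[OF this] obtain ws' where ws': "ws' \<in> lists gens"
    "word_prod W ws' = (f(b := word_prod A as), b)" "length ws' = length ws + length as"
    by blast
  then have c: "ws' \<in> lists (carrier W)" using lists_mono[OF gens_carrier] by auto
  have fW: "(f(b := word_prod A as), b) \<in> carrier W"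
    using W.word_prod_closed[OF c] unfolding ws'(2) .
  have a: "wreath_embed_base A B a \<in> gens" using snoc.prems base_in_gens by simp
  then have "word_prod W (ws' @ [wreath_embed_base A B a]) = (f(b := word_prod A as), b) \<otimes>\<^bsub>W\<^esub> wreath_embed_base A B a"
    using W.word_prod_snoc[OF c] ws'(2) subsetD[OF gens_carrier a] by simp
  also have "\<dots> = (f(b := word_prod A (as @ [a])), b)"
    by (simp only: mult_base[OF fW as(2)] A.word_prod_snoc[OF as] fun_upd_same fun_upd_upd)
  finally show ?case using ws'(1,3) a
    by (intro bexI[of _ "ws' @ [wreath_embed_base A B a]"]) (simp_all del: fun_upd_apply)
qed

lemma append_base:
  assumes "ws \<in> lists gens" "word_prod W ws = (f, b)" "f b = \<one>\<^bsub>A\<^esub>" "a \<in> carrier A"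
  shows "\<exists>ws'\<in>lists gens. word_prod W ws' = (f(b := a), b) \<and> length ws' = length ws + len\<^sub>A a"
proof -
  obtain as where "as \<in> lists S\<^sub>A" "word_prod A as = a" "length as = len\<^sub>A a"
    using word_length_witness[OF word_ex[OF assms(4)]] .
  then show ?thesis using append_base_word[OF assms(1-3)] by metis
qed

text \<open>Follow the walk and set each lamp at the last visit to its vertex. Every lamp is thus
  paid for once, which is why the sum ranges over \<open>set vs\<close> and not over the
  list.\<close>

lemma word_of_walk:
  assumes "walk (cayley_adj B S\<^sub>B) \<one>\<^bsub>B\<^esub> vs b" "f \<in> carrier B \<rightarrow>\<^sub>E carrier A" "supp f \<subseteq> set vs"
  shows "\<exists>ws\<in>lists gens. word_prod W ws = (f, b) \<and>
    Suc (length ws) \<le> length vs + (\<Sum>x\<in>set vs. len\<^sub>A (f x))"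
  using assms
proof (induction vs arbitrary: f b rule: rev_induct)
  case Nil
  then show ?case by (simp add: walk_def)
next
  case (snoc c vs)
  then have bc: "b = c" by (simp add: walk_def)
  show ?case
  proof (cases "vs = []")
    case True
    then have b: "b = \<one>\<^bsub>B\<^esub>" using snoc.prems(1) by (auto simp: walk_def)
    let ?e = "\<lambda>x\<in>carrier B. \<one>\<^bsub>A\<^esub>"
    have "f x = (?e(b := f b)) x" for x
      using snoc.prems(3) True bc PiE_arb[OF snoc.prems(2), of x] by (cases "x = b") auto
    then have "f = ?e(b := f b)" by (rule ext)
    moreover have "f b \<in> carrier A" using PiE_mem[OF snoc.prems(2)] b by simp
    moreover have "word_prod W [] = (?e, b)" "?e b = \<one>\<^bsub>A\<^esub>" by (simp_all add: one_wreath b)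
    ultimately obtain ws where "ws \<in> lists gens" "word_prod W ws = (f, b)" "length ws = len\<^sub>A (f b)"
      using append_base[of "[]" ?e b "f b"] by auto
    then show ?thesis using True bc by (intro bexI[of _ ws]) simp_all
  next
    case False
    \<comment> \<open>Erasing the value at the final vertex \<open>c\<close> postpones that lamp to
      the end, even if \<open>c\<close> also occurs earlier in \<open>vs\<close>.\<close>
    let ?b = "last vs" and ?f = "f(c := \<one>\<^bsub>A\<^esub>)"
    have vs: "walk (cayley_adj B S\<^sub>B) \<one>\<^bsub>B\<^esub> vs ?b" "cayley_adj B S\<^sub>B ?b c"
      using snoc.prems(1) False by (auto simp: walk_def successively_append_iff)
    then obtain s where s: "s \<in> S\<^sub>B" "c = ?b \<otimes>\<^bsub>B\<^esub> s" "?b \<in> carrier B" unfolding cayley_adj_def by blast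
    then have c: "c \<in> carrier B" using S\<^sub>B by auto
    then have "?f \<in> carrier B \<rightarrow>\<^sub>E carrier A" using snoc.prems(2) by (auto simp: PiE_iff extensional_def)
    moreover have "supp ?f \<subseteq> set vs" using snoc.prems(3) by auto
    ultimately obtain ws where ws: "ws \<in> lists gens" "word_prod W ws = (?f, ?b)"
      "Suc (length ws) \<le> length vs + (\<Sum>x\<in>set vs. len\<^sub>A (?f x))"
      using snoc.IH[OF vs(1)] by blast
    then have wsc: "ws \<in> lists (carrier W)" using lists_mono[OF gens_carrier] by auto
    let ?ws = "ws @ [wreath_embed_top A B s]"
    have 1: "?ws \<in> lists gens" using ws(1) top_in_gens[OF s(1)] by simp
    have "word_prod W ?ws = (?f, ?b) \<otimes>\<^bsub>W\<^esub> wreath_embed_top A B s"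
      using W.word_prod_snoc[OF wsc] ws(2) subsetD[OF gens_carrier top_in_gens[OF s(1)]] by simp
    also have "\<dots> = (?f, c)"
      using mult_top W.word_prod_closed[OF wsc] ws(2) s S\<^sub>B by auto
    finally have 2: "word_prod W ?ws = (?f, c)" .
    have fc: "f c \<in> carrier A" using snoc.prems(2) c by auto
    obtain ws' where ws': "ws' \<in> lists gens" "word_prod W ws' = (?f(c := f c), c)"
      "length ws' = length ?ws + len\<^sub>A (f c)"
      using append_base[OF 1 2 _ fc] by auto
    \<comment> \<open>The erased lamp contributes \<open>0\<close>, so \<open>f c\<close> is not
      counted twice when \<open>c\<close> occurs in \<open>vs\<close>.\<close>
    have "(\<Sum>x\<in>set vs. len\<^sub>A (?f x)) = (\<Sum>x\<in>set vs - {c}. len\<^sub>A (f x))"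
      by (rule sum.mono_neutral_cong_right) auto
    moreover have "(\<Sum>x\<in>set (vs @ [c]). len\<^sub>A (f x)) = len\<^sub>A (f c) + (\<Sum>x\<in>set vs - {c}. len\<^sub>A (f x))"
      by (simp add: sum.insert_remove)
    ultimately show ?thesis using ws' ws(3) bc by (intro bexI[of _ ws']) auto
  qed
qed

text \<open>\<open>F\<close> may exceed the support because the estimate is applied to perturbed
  functions, in which some lamps of \<open>F\<close> may have been switched off.\<close>

lemma word_length_wreath_le:
  assumes "f \<in> carrier B \<rightarrow>\<^sub>E carrier A" "supp f \<subseteq> F" "finite F" "F \<subseteq> carrier B"
    and "\<exists>vs. cayley_tour B S\<^sub>B F vs b"
  shows "Suc (word_length W gens (f, b)) \<le> tour_size B S\<^sub>B F b + (\<Sum>x\<in>F. len\<^sub>A (f x))"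
proof -
  obtain vs where vs: "cayley_tour B S\<^sub>B F vs b" "length vs = tour_size B S\<^sub>B F b"
    using tour_size_witness[OF assms(5)] .
  \<comment> \<open>Vertices of the tour outside \<open>F\<close> carry the value one only if they
    lie in the carrier, since \<open>f\<close> is \<open>undefined\<close> elsewhere.\<close>
  have "set vs \<subseteq> carrier B"
  proof -
    have "walk (cayley_adj B S\<^sub>B) p vs q \<Longrightarrow> p \<in> carrier B \<Longrightarrow> set vs \<subseteq> carrier B" for p q vs
    proof (induction vs arbitrary: p)
      case (Cons v vs)
      then show ?case
      proof (cases vs)
        case (Cons w vs')
        then have "walk (cayley_adj B S\<^sub>B) w vs q" "cayley_adj B S\<^sub>B v w" "v = p"
          using Cons.prems by (auto simp: walk_def)
        moreover from this have "w \<in> carrier B" using S\<^sub>B by (auto simp: cayley_adj_def)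
        ultimately show ?thesis using Cons.IH Cons.prems by auto
      qed (auto simp: walk_def)
    qed simp
    then show ?thesis using vs(1) unfolding cayley_tour_def by blast
  qed
  then have "(\<Sum>x\<in>set vs. len\<^sub>A (f x)) = (\<Sum>x\<in>F. len\<^sub>A (f x))"
    using assms(2) vs(1) by (intro sum.mono_neutral_right) (auto simp: cayley_tour_def)
  moreover obtain ws where "ws \<in> lists gens" "word_prod W ws = (f, b)"
    "Suc (length ws) \<le> length vs + (\<Sum>x\<in>set vs. len\<^sub>A (f x))"
    using word_of_walk[of vs b f] vs(1) assms(1,2) unfolding cayley_tour_def by blast
  moreover from this have "word_length W gens (f, b) \<le> length ws" by (simp add: word_length_le)
  ultimately show ?thesis using vs(2) by linarith
qed

text \<open>The converse of \<open>word_length_wreath_le\<close> for \<open>F = supp f\<close>,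
  obtained by applying \<open>tour_of_word\<close> to a shortest word.\<close>

lemma word_length_wreath_ge:
  assumes "(f, b) \<in> carrier W" "\<exists>ws\<in>lists gens. word_prod W ws = (f, b)"
  shows "tour_size B S\<^sub>B (supp f) b + (\<Sum>x\<in>supp f. len\<^sub>A (f x)) \<le> Suc (word_length W gens (f, b))"
proof -
  obtain ws where ws: "ws \<in> lists gens" "word_prod W ws = (f, b)" "length ws = word_length W gens (f, b)"
    using word_length_witness[OF assms(2)] .
  have "finite (supp f)" using assms(1) by (simp add: carrier_wreath)
  then obtain vs where "cayley_tour B S\<^sub>B (supp f) vs b"
    "length vs + (\<Sum>x\<in>supp f. len\<^sub>A (f x)) \<le> Suc (length ws)"
    using tour_of_word[OF ws(1,2)] by auto
  then show ?thesis using tour_size_le[of B S\<^sub>B "supp f" vs b] ws(3) by linarith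
qed

text \<open>Each letter either moves the position by one step or multiplies the lamp at the current
  position by one generator, so a short word acts only nearby and only a little.\<close>

lemma word_action:
  assumes "(f, b) \<in> carrier W" "ws \<in> lists gens" "(f, b) \<otimes>\<^bsub>W\<^esub> word_prod W ws = (f', b')"
  shows "b' \<in> cayley_ball B S\<^sub>B b (length ws) \<and> (\<forall>x\<in>carrier B.
    f' x \<in> cayley_ball A S\<^sub>A (f x) (length ws) \<and> (f' x \<noteq> f x \<longrightarrow> x \<in> cayley_ball B S\<^sub>B b (length ws)))"
  using assms(2,3)
proof (induction ws arbitrary: f' b' rule: rev_induct)
  case Nil
  have "f' = f" "b' = b" using Nil(2) assms(1) by auto
  then show ?case using assms(1) by (auto simp: carrier_wreath intro!: A.cayley_ball_center B.cayley_ball_center)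
next
  case (snoc s ws)
  have fbc: "\<And>x. x \<in> carrier B \<Longrightarrow> f x \<in> carrier A" "b \<in> carrier B"
    using assms(1) by (auto simp: carrier_wreath)
  have ws: "ws \<in> lists (carrier W)" and sW: "s \<in> carrier W"
    using snoc.prems(1) lists_mono[OF gens_carrier] gens_carrier by auto
  obtain f0 b0 where w: "(f, b) \<otimes>\<^bsub>W\<^esub> word_prod W ws = (f0, b0)" by force
  then have c: "(f0, b0) \<in> carrier W" using W.m_closed[OF assms(1) W.word_prod_closed[OF ws]] by simp
  have "(f, b) \<otimes>\<^bsub>W\<^esub> word_prod W (ws @ [s]) = (f0, b0) \<otimes>\<^bsub>W\<^esub> s"
    unfolding W.word_prod_snoc[OF ws sW] w[symmetric]
    using assms(1) W.word_prod_closed[OF ws] sW by (simp add: W.m_assoc)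
  then have fb: "(f0, b0) \<otimes>\<^bsub>W\<^esub> s = (f', b')" using snoc.prems(2) by simp
  have IH: "b0 \<in> cayley_ball B S\<^sub>B b (length ws)"
    "\<And>x. x \<in> carrier B \<Longrightarrow> f0 x \<in> cayley_ball A S\<^sub>A (f x) (length ws)"
    "\<And>x. x \<in> carrier B \<Longrightarrow> f0 x \<noteq> f x \<Longrightarrow> x \<in> cayley_ball B S\<^sub>B b (length ws)"
    using snoc.IH[OF _ w] snoc.prems(1) by auto
  have mono: "cayley_ball G S g (length ws) \<subseteq> cayley_ball G S g (length (ws @ [s]))"
    for G :: "('c, 'k) monoid_scheme" and S g by (rule cayley_ball_mono) simp
  from snoc.prems(1) have "s \<in> gens" by simp
  then show ?case
  proof (cases rule: gens_cases)
    case (1 a)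
    then have f: "f' = f0(b0 := f0 b0 \<otimes>\<^bsub>A\<^esub> a)" "b' = b0"
      using fb mult_base[OF c] S\<^sub>A by auto
    have "b0 \<in> carrier B" using c by (simp add: carrier_wreath)
    then have "f0 b0 \<otimes>\<^bsub>A\<^esub> a \<in> cayley_ball A S\<^sub>A (f b0) (length (ws @ [s]))"
      using A.cayley_ball_step[OF S\<^sub>A fbc(1) IH(2) \<open>a \<in> S\<^sub>A\<close>] by simp
    then show ?thesis using f IH subsetD[OF mono] by (metis fun_upd_apply)
  next
    case (2 t)
    then have f: "f' = f0" "b' = b0 \<otimes>\<^bsub>B\<^esub> t"
      using fb mult_top[OF c] S\<^sub>B by auto
    have "b' \<in> cayley_ball B S\<^sub>B b (length (ws @ [s]))"
      using B.cayley_ball_step[OF S\<^sub>B fbc(2) IH(1) \<open>t \<in> S\<^sub>B\<close>] f by simp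
    then show ?thesis using f IH subsetD[OF mono] by metis
  qed
qed

text \<open>The two terms of the length formula are controlled separately: the lamps by the depth of
  \<open>g\<close> in \<open>A\<close>, the route by the assumption on tours in
  \<open>B\<close>.\<close>

lemma unbounded_depth_wreath:
  assumes A: "carrier A \<noteq> {\<one>\<^bsub>A\<^esub>}" "unbounded_depth A S\<^sub>A"
    and tour: "\<And>F b. finite F \<Longrightarrow> F \<subseteq> carrier B \<Longrightarrow> b \<in> carrier B \<Longrightarrow> \<exists>vs. cayley_tour B S\<^sub>B F vs b"
    and B: "\<And>n. \<exists>F b. finite F \<and> F \<subseteq> carrier B \<and> b \<in> carrier B \<and> cayley_ball B S\<^sub>B b n \<subseteq> F \<and>
      (\<forall>b'\<in>cayley_ball B S\<^sub>B b n. tour_size B S\<^sub>B F b' \<le> tour_size B S\<^sub>B F b)"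
  shows "unbounded_depth W gens"
  unfolding W.unbounded_depth_iff[OF gens_carrier]
proof
  fix n
  obtain F b where F: "finite F" "F \<subseteq> carrier B" "b \<in> carrier B" "cayley_ball B S\<^sub>B b n \<subseteq> F"
    and b: "\<And>b'. b' \<in> cayley_ball B S\<^sub>B b n \<Longrightarrow> tour_size B S\<^sub>B F b' \<le> tour_size B S\<^sub>B F b"
    using B[of n] by blast
  obtain g where g: "g \<in> carrier A"
    "\<And>h. h \<in> cayley_ball A S\<^sub>A g (Suc n) \<Longrightarrow> len\<^sub>A h \<le> len\<^sub>A g"
    using A(2) unfolding A.unbounded_depth_iff[OF S\<^sub>A] by blast
  \<comment> \<open>If the identity had maximal length on a ball of positive radius, every generator
    would have length \<open>0\<close> and \<open>A\<close> would be trivial. The radius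
    \<open>Suc n\<close> is chosen for this; \<open>g\<close> being nontrivial makes the support of
    \<open>f\<close> exactly \<open>F\<close>.\<close>
  have "g \<noteq> \<one>\<^bsub>A\<^esub>"
  proof
    assume g1: "g = \<one>\<^bsub>A\<^esub>"
    have s1: "s = \<one>\<^bsub>A\<^esub>" if "s \<in> S\<^sub>A" for s
    proof -
      have "g \<otimes>\<^bsub>A\<^esub> s \<in> cayley_ball A S\<^sub>A g (Suc n)"
        using A.cayley_ball_step[OF S\<^sub>A g(1) A.cayley_ball_center[OF g(1)] that] .
      then have "len\<^sub>A s = 0" using g(2) g1 that S\<^sub>A by force
      then show ?thesis
        using word_length_witness[OF word_ex] that S\<^sub>A
        by (metis length_0_conv subsetD word_prod_Nil)
    qed
    have "word_prod A ws = \<one>\<^bsub>A\<^esub>" if "ws \<in> lists S\<^sub>A" for ws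
      using that by (induction ws) (auto dest: s1)
    then have "a = \<one>\<^bsub>A\<^esub>" if "a \<in> carrier A" for a using word_ex[OF that] by blast
    then show False using A(1) by blast
  qed
  define f where "f = (\<lambda>x\<in>carrier B. if x \<in> F then g else \<one>\<^bsub>A\<^esub>)"
  have supp: "supp f = F" using F(2) \<open>g \<noteq> \<one>\<^bsub>A\<^esub>\<close> by (auto simp: f_def)
  have f: "f \<in> carrier B \<rightarrow>\<^sub>E carrier A" using g(1) by (auto simp: f_def)
  then have fb: "(f, b) \<in> carrier W" using supp F(1,3) by (simp add: carrier_wreath)
  have "word_length W gens h \<le> word_length W gens (f, b)" if h: "h \<in> cayley_ball W gens (f, b) n" for h
  proof -
    obtain f' b' where h': "h = (f', b')" by force
    obtain ws where ws: "ws \<in> lists gens" "length ws \<le> n" "h = (f, b) \<otimes>\<^bsub>W\<^esub> word_prod W ws"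
      using h unfolding cayley_ball_def by blast
    note ws(3)[symmetric, unfolded h']
    note ws = ws(1,2) this
    then have c: "(f', b') \<in> carrier W"
      using W.m_closed[OF fb W.word_prod_closed[of ws]] lists_mono[OF gens_carrier]
      by (auto simp only: ws(3))
    note action = word_action[OF fb ws(1,3)]
    note mono = cayley_ball_mono[OF ws(2), THEN subsetD] cayley_ball_mono[OF le_SucI[OF ws(2)], THEN subsetD]
    have act: "b' \<in> cayley_ball B S\<^sub>B b n"
      using mono(1)[OF conjunct1[OF action]] .
    have act': "f' x \<in> cayley_ball A S\<^sub>A (f x) (Suc n)" if "x \<in> carrier B" for x
      using mono(2)[of "f' x" A S\<^sub>A "f x"] action that by simp
    have act'': "x \<in> cayley_ball B S\<^sub>B b n" if "x \<in> carrier B" "f' x \<noteq> f x" for x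
      using mono(1)[of x B S\<^sub>B b] action that by simp
    \<comment> \<open>Only lamps within distance \<open>n\<close> of \<open>b\<close> can change,
      and these all lie in \<open>F\<close>.\<close>
    have "f' x = \<one>\<^bsub>A\<^esub>" if "x \<in> carrier B" "x \<notin> F" for x
      using act''[OF that(1)] that F(4) by (auto simp: f_def)
    then have "supp f' \<subseteq> F" by blast
    moreover have "f' \<in> carrier B \<rightarrow>\<^sub>E carrier A" "b' \<in> carrier B" using c by (auto simp: carrier_wreath)
    ultimately have "Suc (word_length W gens (f', b')) \<le> tour_size B S\<^sub>B F b' + (\<Sum>x\<in>F. len\<^sub>A (f' x))"
      using word_length_wreath_le tour F(1,2) by blast
    also have "\<dots> \<le> tour_size B S\<^sub>B F b + (\<Sum>x\<in>F. len\<^sub>A (f x))"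
    proof (intro add_mono sum_mono)
      fix x assume x: "x \<in> F"
      then have "f x = g" "x \<in> carrier B" using F(2) by (auto simp: f_def)
      then show "len\<^sub>A (f' x) \<le> len\<^sub>A (f x)" using g(2) act'[of x] by simp
    qed (rule b[OF act])
    also have "\<dots> \<le> Suc (word_length W gens (f, b))"
    proof -
      have "\<exists>ws\<in>lists gens. word_prod W ws = (f, b)"
        using word_of_walk[OF _ f] tour[OF F(1-3)] unfolding cayley_tour_def supp by blast
      from word_length_wreath_ge[OF fb this] show ?thesis unfolding supp .
    qed
    finally show ?thesis using h' by simp
  qed
  then show "\<exists>g\<in>carrier W. \<forall>h\<in>cayley_ball W gens g n. word_length W gens h \<le> word_length W gens g"
    using fb by blast
qed

end


section \<open>Tours in abelian Cayley graphs\<close>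

locale abelian_cayley = comm_group G for G :: "('a, 'm) monoid_scheme" (structure) +
  fixes S :: "'a set"
  assumes gens: "finite_symmetric_generating_set G S"
begin

lemma finite_S: "finite S" and S_carrier: "S \<subseteq> carrier G"
  and S_inv: "s \<in> S \<Longrightarrow> inv s \<in> S" and generate_S: "generate G S = carrier G"
  using gens unfolding finite_symmetric_generating_set_def by auto

abbreviation "adj \<equiv> cayley_adj G S"
abbreviation "ball \<equiv> cayley_ball G S"

lemma adjI: "x \<in> carrier G \<Longrightarrow> s \<in> S \<Longrightarrow> adj x (x \<otimes> s)"
  unfolding cayley_adj_def by blast

lemma adj_sym:
  assumes "adj x y"
  shows "adj y x"
proof -
  obtain s where s: "x \<in> carrier G" "s \<in> S" "y = x \<otimes> s"
    using assms unfolding cayley_adj_def by blast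
  then have c: "s \<in> carrier G" using S_carrier by auto
  then have "x = y \<otimes> inv s" using s by (simp add: m_assoc)
  moreover have "adj y (y \<otimes> inv s)" using s c S_inv by (intro adjI) auto
  ultimately show ?thesis by simp
qed

lemma adj_translate:
  assumes "c \<in> carrier G" "adj x y"
  shows "adj (c \<otimes> x) (c \<otimes> y)"
proof -
  obtain s where s: "x \<in> carrier G" "s \<in> S" "y = x \<otimes> s"
    using assms unfolding cayley_adj_def by blast
  then have "c \<otimes> y = c \<otimes> x \<otimes> s" using assms(1) S_carrier by (auto simp: m_assoc)
  then show ?thesis using adjI[of "c \<otimes> x" s] assms(1) s by simp
qed

lemma word_walk:
  assumes "ws \<in> lists S" "p \<in> carrier G"
  shows "\<exists>vs. walk adj p vs (p \<otimes> word_prod G ws)"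
  using assms
proof (induction ws arbitrary: p)
  case Nil
  then show ?case by (intro exI[of _ "[p]"]) simp
next
  case (Cons s ws)
  then have p: "p \<in> carrier G" by blast
  have s: "s \<in> S" "s \<in> carrier G" "ws \<in> lists S" "ws \<in> lists (carrier G)"
    using Cons.hyps S_carrier lists_mono[OF S_carrier] by auto
  then obtain vs where "walk adj (p \<otimes> s) vs (p \<otimes> s \<otimes> word_prod G ws)"
    using Cons.IH[of "p \<otimes> s"] p by auto
  then have "walk adj p (p # vs) (p \<otimes> s \<otimes> word_prod G ws)"
    using walk_Cons[of adj p "p \<otimes> s"] adjI[of p s] s(1) p by simp
  moreover have "p \<otimes> s \<otimes> word_prod G ws = p \<otimes> word_prod G (s # ws)"
    using p s word_prod_closed by (simp add: m_assoc)
  ultimately show ?case by metis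
qed

lemma word_ex: "g \<in> carrier G \<Longrightarrow> \<exists>ws\<in>lists S. word_prod G ws = g"
  using generate_word[OF S_carrier S_inv] generate_S by blast

lemma walk_ex:
  assumes "p \<in> carrier G" "q \<in> carrier G"
  shows "\<exists>vs. walk adj p vs q"
proof -
  obtain ws where "ws \<in> lists S" "word_prod G ws = inv p \<otimes> q"
    using word_ex[of "inv p \<otimes> q"] assms by auto
  moreover have "p \<otimes> (inv p \<otimes> q) = q" using assms by (simp flip: m_assoc)
  ultimately show ?thesis using word_walk[of ws p] assms by simp
qed

lemma tour_ex:
  assumes "finite F" "F \<subseteq> carrier G" "q \<in> carrier G"
  shows "\<exists>vs. cayley_tour G S F vs q"
  using assms
proof (induction F arbitrary: q)
  case empty
  then show ?case using walk_ex[of \<one> q] unfolding cayley_tour_def by auto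
next
  case (insert x F)
  then obtain us where us: "walk adj \<one> us x" "F \<subseteq> set us" unfolding cayley_tour_def by force
  then have "x \<in> set us" unfolding walk_def by auto
  obtain vs where "walk adj x vs q" using walk_ex[of x q] insert.prems by auto
  from walk_join[OF us(1) this] obtain ws where "walk adj \<one> ws q" "set ws = set us \<union> set vs"
    by metis
  then show ?case using us(2) \<open>x \<in> set us\<close> unfolding cayley_tour_def by auto
qed

lemma card_le_tour_size:
  assumes "finite F" "F \<subseteq> carrier G" "q \<in> carrier G"
  shows "card F \<le> tour_size G S F q"
proof -
  obtain vs where "cayley_tour G S F vs q" "length vs = tour_size G S F q"
    using tour_size_witness[OF tour_ex[OF assms]] .
  then show ?thesis
    unfolding cayley_tour_def by (metis card_mono card_length finite_set le_trans)
qed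

text \<open>Moving to a larger value within distance \<open>n\<close> uses up \<open>n\<close> of
  the radius and at least one of the \<open>C\<close> units by which \<open>K\<close> can still
  grow. Once \<open>C\<close> is exhausted, the centre is maximal on all of
  \<open>F\<close>.\<close>

lemma local_max_in_ball:
  fixes K :: "'a \<Rightarrow> nat"
  assumes "b \<in> carrier G" "ball b (Suc C * n) \<subseteq> F" "\<And>q. q \<in> F \<Longrightarrow> K q \<le> K b + C"
  shows "\<exists>q\<in>carrier G. ball q n \<subseteq> F \<and> (\<forall>q'\<in>ball q n. K q' \<le> K q)"
  using assms
proof (induction C arbitrary: b)
  case 0
  then show ?case by auto
next
  case (Suc C)
  have n: "ball b n \<subseteq> F"
    using Suc.prems(2) cayley_ball_mono[of n "Suc (Suc C) * n" G S b] by auto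
  show ?case
  proof (cases "\<forall>q'\<in>ball b n. K q' \<le> K b")
    case True
    then show ?thesis using n Suc.prems(1) by blast
  next
    case False
    then obtain b' where b': "b' \<in> ball b n" "K b < K b'" by (auto simp: not_le)
    have "b' \<in> carrier G"
      using b'(1) cayley_ball_subset_carrier[OF S_carrier Suc.prems(1)] by auto
    moreover have "ball b' (Suc C * n) \<subseteq> F"
    proof
      fix x assume "x \<in> ball b' (Suc C * n)"
      then have "x \<in> ball b (n + Suc C * n)"
        by (rule cayley_ball_trans[OF S_carrier Suc.prems(1) b'(1)])
      then show "x \<in> F" using Suc.prems(2) by auto
    qed
    moreover have "K q \<le> K b' + C" if "q \<in> F" for q
      using Suc.prems(3)[OF that] b'(2) by simp
    ultimately show ?thesis by (rule Suc.IH)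
  qed
qed

text \<open>Commutativity allows all powers of \<open>s\<close> to be collected in front.\<close>

lemma generate_insert_decomp:
  assumes "U \<subseteq> carrier G" "s \<in> carrier G" "x \<in> generate G (insert s U)"
  shows "\<exists>h\<in>generate G U. \<exists>k::int. x = s [^] k \<otimes> h"
  using assms(3)
proof induction
  case one
  then show ?case using assms(2) by (intro bexI[of _ \<one>] exI[of _ 0]) (auto intro: generate.one)
next
  case (incl h)
  show ?case
  proof (cases "h = s")
    case True
    then show ?thesis using assms(2) by (intro bexI[of _ \<one>] exI[of _ 1]) (auto intro: generate.one)
  next
    case False
    then show ?thesis using incl assms(1)
      by (intro bexI[of _ h] exI[of _ 0]) (auto intro: generate.incl)
  qed
next
  case (inv h)
  show ?case
  proof (cases "h = s")
    case True
    then show ?thesis using assms(2)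
      by (intro bexI[of _ \<one>] exI[of _ "- 1"]) (auto intro: generate.one simp: int_pow_neg)
  next
    case False
    then show ?thesis using inv assms(1)
      by (intro bexI[of _ "inv h"] exI[of _ 0]) (auto intro: generate.inv)
  qed
next
  case (eng x y)
  then obtain h k h' k' where h: "h \<in> generate G U" "x = s [^] (k::int) \<otimes> h"
    "h' \<in> generate G U" "y = s [^] (k'::int) \<otimes> h'" by blast
  then have c: "h \<in> carrier G" "h' \<in> carrier G" using generate_in_carrier[OF assms(1)] by auto
  have "x \<otimes> y = s [^] (k + k') \<otimes> (h \<otimes> h')"
    using h c assms(2) by (simp add: int_pow_mult m_ac)
  moreover have "h \<otimes> h' \<in> generate G U" using h by (intro generate.eng)
  ultimately show ?case by blast
qed

text \<open>Exponents may be reduced modulo the order, so adding a generator multiplies the size of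
  the generated subgroup by at most its order.\<close>

lemma finite_carrier_if_torsion:
  assumes "\<And>s. s \<in> S \<Longrightarrow> ord s \<noteq> 0"
  shows "finite (carrier G)"
proof -
  have "finite U \<Longrightarrow> U \<subseteq> S \<Longrightarrow> finite (generate G U)" for U
  proof (induction U rule: finite_induct)
    case empty
    then show ?case by (simp add: generate_empty)
  next
    case (insert s U)
    then have s: "s \<in> carrier G" "U \<subseteq> carrier G" "ord s > 0" using S_carrier assms by auto
    have "generate G (insert s U) \<subseteq> (\<lambda>(j, h). s [^] (j::int) \<otimes> h) ` ({0..<int (ord s)} \<times> generate G U)"
    proof
      fix x assume "x \<in> generate G (insert s U)"
      then obtain h k where h: "h \<in> generate G U" "x = s [^] (k::int) \<otimes> h"
        using generate_insert_decomp[OF s(2,1)] by blast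
      have "s [^] k = s [^] (k mod int (ord s))"
        using s(1) by (simp add: int_pow_eq flip: mod_eq_dvd_iff)
      then have "x = (\<lambda>(j, h). s [^] (j::int) \<otimes> h) (k mod int (ord s), h)" using h(2) by simp
      then show "x \<in> (\<lambda>(j, h). s [^] (j::int) \<otimes> h) ` ({0..<int (ord s)} \<times> generate G U)"
        using h(1) s(3) by (intro image_eqI[of _ _ "(k mod int (ord s), h)"]) auto
    qed
    moreover have "finite (generate G U)" using insert by auto
    ultimately show ?case by (meson finite_SigmaI finite_atLeastLessThan_int finite_imageI finite_subset)
  qed
  from this[OF finite_S] show ?thesis by (simp add: generate_S)
qed

section \<open>Paths transversal to a subgroup\<close>

text \<open>The vertices lie in pairwise distinct left cosets of \<open>T\<close>: the path projects
  to a simple path in the quotient. Comparing each vertex only with later ones suffices for a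
  subgroup \<open>T\<close>.\<close>

definition transversal_path :: "'a set \<Rightarrow> 'a list \<Rightarrow> bool"
  where "transversal_path T vs \<longleftrightarrow> vs \<noteq> [] \<and> set vs \<subseteq> carrier G \<and> successively adj vs \<and>
    sorted_wrt (\<lambda>x y. inv x \<otimes> y \<notin> T) vs"

lemma transversal_path_rev:
  assumes "transversal_path T vs" "subgroup T G"
  shows "transversal_path T (rev vs)"
proof -
  have vs: "vs \<noteq> []" "set vs \<subseteq> carrier G" "successively adj vs"
    "sorted_wrt (\<lambda>x y. inv x \<otimes> y \<notin> T) vs"
    using assms(1) unfolding transversal_path_def by auto
  have "inv y \<otimes> x \<notin> T" if "x \<in> set vs" "y \<in> set vs" "inv x \<otimes> y \<notin> T" for x y
  proof
    assume "inv y \<otimes> x \<in> T"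
    then have "inv (inv y \<otimes> x) \<in> T" using subgroup.m_inv_closed[OF assms(2)] by blast
    moreover have "inv (inv y \<otimes> x) = inv x \<otimes> y"
    proof -
      have "x \<in> carrier G" "y \<in> carrier G" using that vs(2) by auto
      then show ?thesis by (simp add: inv_mult_group)
    qed
    ultimately show False using that(3) by simp
  qed
  then have "sorted_wrt (\<lambda>x y. inv y \<otimes> x \<notin> T) vs"
    using vs(4) by (rule sorted_wrt_mono_rel)
  moreover have "successively (\<lambda>x y. adj y x) vs"
    using vs(3) by (rule successively_mono) (rule adj_sym)
  ultimately show ?thesis
    using vs(1,2) unfolding transversal_path_def by (simp add: sorted_wrt_rev successively_rev)
qed

lemma transversal_path_translate:
  assumes "transversal_path T vs" "c \<in> carrier G"
  shows "transversal_path T (map (\<lambda>v. c \<otimes> v) vs)"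
proof -
  have vs: "vs \<noteq> []" "set vs \<subseteq> carrier G" "successively adj vs"
    "sorted_wrt (\<lambda>x y. inv x \<otimes> y \<notin> T) vs"
    using assms(1) unfolding transversal_path_def by auto
  have "inv (c \<otimes> x) \<otimes> (c \<otimes> y) = inv x \<otimes> y" if "x \<in> carrier G" "y \<in> carrier G" for x y
  proof -
    have "inv (c \<otimes> x) \<otimes> (c \<otimes> y) = inv x \<otimes> (inv c \<otimes> c) \<otimes> y"
      using that assms(2) by (simp only: inv_mult_group m_assoc inv_closed m_closed)
    then show ?thesis using that assms(2) by simp
  qed
  then have "inv (c \<otimes> x) \<otimes> (c \<otimes> y) \<notin> T" if "x \<in> set vs" "y \<in> set vs" "inv x \<otimes> y \<notin> T" for x y
    using that vs(2) by (metis subsetD)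
  then have "sorted_wrt (\<lambda>x y. inv (c \<otimes> x) \<otimes> (c \<otimes> y) \<notin> T) vs"
    using vs(4) by (rule sorted_wrt_mono_rel)
  moreover have "successively (\<lambda>x y. adj (c \<otimes> x) (c \<otimes> y)) vs"
    using vs(3) by (rule successively_mono) (rule adj_translate[OF assms(2)])
  ultimately show ?thesis
    using vs(1,2) assms(2) unfolding transversal_path_def
    by (auto simp: sorted_wrt_map successively_map)
qed

text \<open>Traverse the translates of \<open>vs\<close> by \<open>1, s, ..., s^m\<close>
  alternately forwards and backwards. Successive copies are joined by a step \<open>s\<close>, and
  different copies lie in different cosets of \<open>H\<close>, hence of \<open>T\<close>. The final
  disjunction records the direction for the next copy.\<close>

lemma snake:
  assumes T: "subgroup T G" "T \<subseteq> H" and H: "subgroup H G"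
    and vs: "transversal_path T vs" "set vs \<subseteq> H" and s: "s \<in> S"
    and m: "\<And>j::nat. 0 < j \<Longrightarrow> j \<le> m \<Longrightarrow> s [^] j \<notin> H"
  shows "\<exists>ws. transversal_path T ws \<and> set ws = (\<Union>j\<le>m. (\<lambda>v. s [^] j \<otimes> v) ` set vs) \<and>
    (last ws = s [^] m \<otimes> hd vs \<or> last ws = s [^] m \<otimes> last vs)"
  using m
proof (induction m)
  case 0
  have "map (\<lambda>v. s [^] (0::nat) \<otimes> v) vs = vs"
    using vs(1) unfolding transversal_path_def by (auto intro!: map_idI)
  then have "(\<lambda>v. s [^] (0::nat) \<otimes> v) ` set vs = set vs" by (metis set_map)
  moreover have "\<one> \<otimes> last vs = last vs"
    using vs(1) unfolding transversal_path_def by (auto simp: subset_iff)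
  ultimately show ?case using vs(1) by (intro exI[of _ vs]) auto
next
  case (Suc m)
  then obtain ws where ws: "transversal_path T ws"
    "set ws = (\<Union>j\<le>m. (\<lambda>v. s [^] j \<otimes> v) ` set vs)"
    "last ws = s [^] m \<otimes> hd vs \<or> last ws = s [^] m \<otimes> last vs" by auto
  have sc: "s \<in> carrier G" using s S_carrier by auto
  have vs': "vs \<noteq> []" "set vs \<subseteq> carrier G" using vs(1) unfolding transversal_path_def by auto
  \<comment> \<open>Orient the next copy so that it starts above the vertex where the snake has
    ended.\<close>
  obtain us where us: "transversal_path T us" "set us = set vs" "last ws = s [^] m \<otimes> hd us"
    "last us = hd vs \<or> last us = last vs"
  proof (cases "last ws = s [^] m \<otimes> hd vs")
    case True
    then show thesis using that[of vs] vs(1) by simp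
  next
    case False
    then show thesis using that[of "rev vs"] transversal_path_rev[OF vs(1) T(1)] ws(3) vs'(1)
      by (simp add: hd_rev last_rev)
  qed
  let ?us = "map (\<lambda>v. s [^] Suc m \<otimes> v) us"
  have tus: "transversal_path T ?us" using us(1) sc by (intro transversal_path_translate) auto
  have us': "us \<noteq> []" using us(1) unfolding transversal_path_def by auto
  then have "hd us \<in> carrier G" using us(2) vs'(2) hd_in_set by blast
  then have "s [^] Suc m \<otimes> hd us = last ws \<otimes> s"
    using us(3) sc by (simp add: m_ac)
  moreover have "last ws \<in> carrier G" using ws(1) unfolding transversal_path_def by auto
  ultimately have "adj (last ws) (hd ?us)" using us' s adjI by (simp add: hd_map)
  moreover have "inv x \<otimes> y \<notin> T" if x: "x \<in> set ws" and y: "y \<in> set ?us" for x y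
  proof
    assume xy: "inv x \<otimes> y \<in> T"
    obtain j v where j: "j \<le> m" "v \<in> set vs" "x = s [^] j \<otimes> v" using x ws(2) by blast
    obtain u where u: "u \<in> set vs" "y = s [^] Suc m \<otimes> u" using y us(2) by auto
    have c: "v \<in> carrier G" "u \<in> carrier G" using j u vs' by auto
    have "y = s [^] j \<otimes> s [^] (Suc m - j) \<otimes> u" using u(2) j(1) sc by (simp add: nat_pow_mult)
    \<comment> \<open>Cancelling \<open>s [^] j\<close> shows that a common coset would put the
      positive power \<open>s [^] (Suc m - j)\<close> into \<open>H\<close>.\<close>
    then have "inv x \<otimes> y = (inv (s [^] j) \<otimes> s [^] j) \<otimes> (s [^] (Suc m - j) \<otimes> (inv v \<otimes> u))"
      using j(3) sc c by (simp only: inv_mult_group m_ac inv_closed m_closed nat_pow_closed)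
    also have "\<dots> = s [^] (Suc m - j) \<otimes> (inv v \<otimes> u)" using sc c by simp
    finally have "s [^] (Suc m - j) \<otimes> (inv v \<otimes> u) \<in> H" using xy T(2) by auto
    moreover have "inv v \<otimes> u \<in> H"
      using j u vs(2) H by (auto intro: subgroup.m_closed subgroup.m_inv_closed)
    ultimately have "s [^] (Suc m - j) \<otimes> (inv v \<otimes> u) \<otimes> inv (inv v \<otimes> u) \<in> H"
      using H by (auto intro: subgroup.m_closed subgroup.m_inv_closed)
    moreover have "s [^] (Suc m - j) \<otimes> (inv v \<otimes> u) \<otimes> inv (inv v \<otimes> u) = s [^] (Suc m - j)"
      using sc c by (simp add: m_assoc)
    ultimately show False using Suc.prems[of "Suc m - j"] j(1) by simp
  qed
  ultimately have "transversal_path T (ws @ ?us)"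
    using ws(1) tus unfolding transversal_path_def
    by (simp add: successively_append_iff sorted_wrt_append)
  moreover have "set (ws @ ?us) = (\<Union>j\<le>Suc m. (\<lambda>v. s [^] j \<otimes> v) ` set vs)"
    using ws(2) us(2) by (auto simp: atMost_Suc)
  moreover have "last (ws @ ?us) = s [^] Suc m \<otimes> last us" using us' by (simp add: last_map)
  ultimately show ?case using us(4) by metis
qed


text \<open>If a positive power of \<open>s\<close> lies in \<open>H\<close>, take the exponents
  below the least such power. Otherwise all powers of \<open>s\<close> are distinct modulo
  \<open>H\<close>, and an interval around \<open>0\<close> containing the finitely many exponents
  occurring in \<open>Y\<close> will do.\<close>

lemma exponent_window:
  assumes H: "subgroup H G" and s: "s \<in> carrier G" and fin: "finite Y"
    and Y: "\<forall>x\<in>Y. \<exists>h\<in>H. \<exists>k::int. x = s [^] k \<otimes> h"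
  obtains k0 :: int and m :: nat where "\<And>j::nat. 0 < j \<Longrightarrow> j \<le> m \<Longrightarrow> s [^] j \<notin> H"
    and "\<And>x. x \<in> Y \<Longrightarrow> \<exists>h\<in>H. \<exists>j\<le>m. x = s [^] (k0 + int j) \<otimes> h"
proof (cases "\<exists>d::nat. 0 < d \<and> s [^] d \<in> H")
  case True
  define d where "d = (LEAST d::nat. 0 < d \<and> s [^] d \<in> H)"
  have d: "0 < d" "s [^] d \<in> H"
    using LeastI_ex[OF True] unfolding d_def by auto
  have min: "s [^] j \<notin> H" if "0 < j" "j \<le> d - 1" for j
  proof
    assume "s [^] j \<in> H"
    then have "d \<le> j" unfolding d_def using that(1) by (intro Least_le) simp
    then show False using that d(1) by simp
  qed
  have "\<exists>h\<in>H. \<exists>j\<le>d - 1. x = s [^] (0 + int j) \<otimes> h" if "x \<in> Y" for x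
  proof -
    obtain h k where h: "h \<in> H" "x = s [^] (k::int) \<otimes> h" using Y \<open>x \<in> Y\<close> by blast
    have hc: "h \<in> carrier G" using h(1) subgroup.subset[OF H] by auto
    let ?j = "nat (k mod int d)"
    have j: "int ?j = k mod int d" "?j \<le> d - 1" using d(1) by (auto simp: nat_le_iff)
    have "s [^] k = s [^] (k mod int d + int d * (k div int d))" by simp
    also have "\<dots> = s [^] (k mod int d) \<otimes> (s [^] d) [^] (k div int d)"
      using s by (simp only: int_pow_mult int_pow_pow int_pow_closed flip: int_pow_int)
    finally have "x = s [^] (0 + int ?j) \<otimes> ((s [^] d) [^] (k div int d) \<otimes> h)"
      using h(2) hc s j(1) by (simp add: m_assoc)
    moreover have "(s [^] d) [^] (k div int d) \<otimes> h \<in> H"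
      using subgroup_int_pow_closed[OF H d(2)] h(1) H by (simp add: subgroup.m_closed)
    ultimately show ?thesis using j(2) by blast
  qed
  with min show thesis by (rule that)
next
  case False
  obtain k h where k: "\<And>x. x \<in> Y \<Longrightarrow> h x \<in> H \<and> x = s [^] (k x::int) \<otimes> h x"
    using Y by metis
  \<comment> \<open>The sum serves as a common bound that is also defined for empty
    \<open>Y\<close>.\<close>
  define M where "M = (\<Sum>x\<in>Y. \<bar>k x\<bar>)"
  have M: "\<bar>k x\<bar> \<le> M" if "x \<in> Y" for x
    unfolding M_def using fin that by (intro member_le_sum) auto
  have "\<exists>h\<in>H. \<exists>j\<le>nat (2 * M). x = s [^] (- M + int j) \<otimes> h" if "x \<in> Y" for x
  proof -
    have "- M + int (nat (k x + M)) = k x" "nat (k x + M) \<le> nat (2 * M)" using M[OF that] by auto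
    then show ?thesis using k[OF that] by (intro bexI[of _ "h x"] exI[of _ "nat (k x + M)"]) auto
  qed
  moreover have "s [^] j \<notin> H" if "0 < j" for j :: nat using False that by blast
  ultimately show thesis by (intro that[of "nat (2 * M)" "- M"])
qed

text \<open>Induction on \<open>U\<close>: a path through the required cosets inside the subgroup
  generated by \<open>U\<close> and \<open>T\<close> is swept along the powers of the new generator
  \<open>s\<close> by \<open>snake\<close>.\<close>

lemma transversal_path_ex:
  assumes T: "subgroup T G"
  shows "finite U \<Longrightarrow> U \<subseteq> S \<Longrightarrow> finite Y \<Longrightarrow> Y \<subseteq> generate G (U \<union> T) \<Longrightarrow>
    \<exists>vs. transversal_path T vs \<and> set vs \<subseteq> generate G (U \<union> T) \<and>
      (\<forall>x\<in>Y. \<exists>v\<in>set vs. \<exists>t\<in>T. x = v \<otimes> t)"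
proof (induction U arbitrary: Y rule: finite_induct)
  case empty
  have "generate G T = T"
    using generate_subgroup_incl[OF subset_refl T] by (auto intro: generate.incl)
  then have "Y \<subseteq> T" using empty.prems by simp
  then have "x \<in> T \<and> x = \<one> \<otimes> x" if "x \<in> Y" for x
    using subgroup.subset[OF T] that by auto
  then have "\<forall>x\<in>Y. \<exists>v\<in>set [\<one>]. \<exists>t\<in>T. x = v \<otimes> t"
    by auto
  moreover have "transversal_path T [\<one>]" by (simp add: transversal_path_def)
  ultimately show ?case by (intro exI[of _ "[\<one>]"]) (auto intro: generate.one)
next
  case (insert s U)
  let ?H = "generate G (U \<union> T)"
  have s: "s \<in> S" "s \<in> carrier G" and UT: "U \<union> T \<subseteq> carrier G"
    using insert.prems S_carrier subgroup.subset[OF T] by auto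
  have H: "subgroup ?H G" using generate_is_subgroup[OF UT] .
  have decomp: "\<forall>x\<in>Y. \<exists>h\<in>?H. \<exists>k::int. x = s [^] k \<otimes> h"
    using generate_insert_decomp[OF UT s(2)] insert.prems(3) by auto
  obtain k0 m where m: "\<And>j::nat. 0 < j \<Longrightarrow> j \<le> m \<Longrightarrow> s [^] j \<notin> ?H"
    and km: "\<And>x. x \<in> Y \<Longrightarrow> \<exists>h\<in>?H. \<exists>j\<le>m. x = s [^] (k0 + int j) \<otimes> h"
    by (rule exponent_window[OF H s(2) insert.prems(2) decomp]) (rule that)
  \<comment> \<open>All parts in \<open>?H\<close> that remain when a power of \<open>s\<close> from
    the window is removed from an element of \<open>Y\<close>; these are what the smaller path has
    to cover.\<close>
  let ?Z = "(\<Union>j\<le>m. (\<lambda>x. inv (s [^] (k0 + int j)) \<otimes> x) ` Y) \<inter> ?H"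
  have "finite ?Z" using insert.prems(2) by auto
  with insert.IH[of ?Z] insert.prems(1) obtain vs where
    vs: "transversal_path T vs" "set vs \<subseteq> ?H" "\<And>x. x \<in> ?Z \<Longrightarrow> \<exists>v\<in>set vs. \<exists>t\<in>T. x = v \<otimes> t"
    by (metis (no_types, lifting) Int_lower2 insert_subset)
  have "T \<subseteq> ?H" by (auto intro: generate.incl)
  then have "\<exists>ws. transversal_path T ws \<and> set ws = (\<Union>j\<le>m. (\<lambda>v. s [^] j \<otimes> v) ` set vs) \<and>
      (last ws = s [^] m \<otimes> hd vs \<or> last ws = s [^] m \<otimes> last vs)"
    by (rule snake[OF T _ H vs(1,2) s(1)]) (rule m)
  then obtain ws where
    ws: "transversal_path T ws" "set ws = (\<Union>j\<le>m. (\<lambda>v. s [^] j \<otimes> v) ` set vs)" by blast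
  \<comment> \<open>The snake uses the exponents \<open>0\<close> to \<open>m\<close>; translation
    moves them to the window starting at \<open>k0\<close>.\<close>
  let ?ws = "map (\<lambda>v. s [^] k0 \<otimes> v) ws"
  have sH: "s [^] k \<in> generate G (insert s U \<union> T)" for k :: int
    using s(2) UT by (intro subgroup_int_pow_closed generate_is_subgroup) (auto intro: generate.incl)
  have H_le: "?H \<subseteq> generate G (insert s U \<union> T)" by (rule mono_generate) auto
  have "transversal_path T ?ws" using ws(1) s(2) by (intro transversal_path_translate) auto
  moreover have "set ?ws \<subseteq> generate G (insert s U \<union> T)"
  proof
    fix y assume "y \<in> set ?ws"
    then obtain j v where "v \<in> set vs" "y = s [^] k0 \<otimes> (s [^] int j \<otimes> v)"
      unfolding set_map ws(2) int_pow_int by blast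
    then show "y \<in> generate G (insert s U \<union> T)"
      using sH H_le vs(2) by (auto intro!: generate.eng)
  qed
  moreover have "\<exists>v\<in>set ?ws. \<exists>t\<in>T. x = v \<otimes> t" if x: "x \<in> Y" for x
  proof -
    obtain h j where h: "h \<in> ?H" "j \<le> m" "x = s [^] (k0 + int j) \<otimes> h" using km[OF x] by blast
    have hc: "h \<in> carrier G" using h(1) subgroup.subset[OF H] by auto
    have "h = inv (s [^] (k0 + int j)) \<otimes> x" using h(3) hc s(2) by (simp flip: m_assoc)
    then have "h \<in> ?Z" using h(1,2) x by blast
    then obtain v t where v: "v \<in> set vs" "t \<in> T" "h = v \<otimes> t" using vs(3) by blast
    have c: "v \<in> carrier G" "t \<in> carrier G"
      using v vs(2) subgroup.subset[OF H] subgroup.subset[OF T] by auto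
    have "x = (s [^] k0 \<otimes> (s [^] j \<otimes> v)) \<otimes> t"
      using h(3) v(3) c s(2) by (simp add: int_pow_mult int_pow_int m_assoc)
    moreover have "s [^] k0 \<otimes> (s [^] j \<otimes> v) \<in> set ?ws"
      using v(1) h(2) unfolding set_map ws(2) by blast
    ultimately show ?thesis using v(2) by blast
  qed
  ultimately show ?case by blast
qed


section \<open>Deep local maxima of the tour length\<close>

text \<open>The condition on \<open>B\<close> in \<open>unbounded_depth_wreath\<close>, for a single
  radius \<open>n\<close>.\<close>

abbreviation deep_maximum :: "nat \<Rightarrow> bool"
  where "deep_maximum n \<equiv> \<exists>F q. finite F \<and> F \<subseteq> carrier G \<and> q \<in> carrier G \<and> ball q n \<subseteq> F \<and>
    (\<forall>q'\<in>ball q n. tour_size G S F q' \<le> tour_size G S F q)"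

lemma deep_maximumI:
  assumes "finite F" "F \<subseteq> carrier G" "b \<in> carrier G" "ball b (Suc C * n) \<subseteq> F"
    and "\<And>q. q \<in> F \<Longrightarrow> tour_size G S F q \<le> tour_size G S F b + C"
  shows "deep_maximum n"
  using local_max_in_ball[where K = "tour_size G S F", OF assms(3-5)] assms(1,2) by blast

text \<open>With \<open>F\<close> the whole group every ball is contained in \<open>F\<close>, and
  the sum of all tour sizes is a crude bound \<open>C\<close> for their variation.\<close>

lemma deep_maximum_finite:
  assumes "finite (carrier G)"
  shows "deep_maximum n"
proof -
  let ?C = "\<Sum>q\<in>carrier G. tour_size G S (carrier G) q"
  have "ball \<one> (Suc ?C * n) \<subseteq> carrier G" by (intro cayley_ball_subset_carrier S_carrier) simp
  moreover have "tour_size G S (carrier G) q \<le> tour_size G S (carrier G) \<one> + ?C" if "q \<in> carrier G" for q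
    using member_le_sum[of q "carrier G" "tour_size G S (carrier G)"] assms that by simp
  ultimately show ?thesis by (rule deep_maximumI[OF assms subset_refl one_closed])
qed

text \<open>Turns a coincidence of two grid points into a relation between the coset representatives
  \<open>v\<close> and \<open>w\<close>.\<close>

lemma cross_mult:
  assumes "a \<in> carrier G" "b \<in> carrier G" "v \<in> carrier G" "w \<in> carrier G" "a \<otimes> v = b \<otimes> w"
  shows "inv v \<otimes> w = a \<otimes> inv b"
proof -
  have "inv v \<otimes> w = inv v \<otimes> w \<otimes> (b \<otimes> inv b)" using assms(1-4) by simp
  also have "\<dots> = inv v \<otimes> (b \<otimes> w) \<otimes> inv b"
    using assms(1-4) by (simp only: m_ac m_closed inv_closed)
  also have "\<dots> = (inv v \<otimes> v) \<otimes> (a \<otimes> inv b)"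
    unfolding assms(5)[symmetric] using assms(1-4) by (simp only: m_ac m_closed inv_closed)
  also have "\<dots> = a \<otimes> inv b" using assms(1-4) by simp
  finally show ?thesis .
qed

lemma int_pow_inj:
  assumes "t \<in> carrier G" "ord t = 0" "t [^] (i::int) = t [^] (j::int)"
  shows "i = j"
  using assms by (simp add: int_pow_eq)

lemma ball_translate:
  assumes "c \<in> carrier G" "x \<in> ball c n"
  shows "\<exists>y\<in>ball \<one> n. x = c \<otimes> y"
proof -
  obtain ws where ws: "ws \<in> lists S" "length ws \<le> n" "x = c \<otimes> word_prod G ws"
    using assms(2) unfolding cayley_ball_def by blast
  then have "word_prod G ws \<in> carrier G" using lists_mono[OF S_carrier] by auto
  then have "word_prod G ws = \<one> \<otimes> word_prod G ws" by simp
  then have "word_prod G ws \<in> ball \<one> n" using ws(1,2) unfolding cayley_ball_def by blast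
  then show ?thesis using ws(3) by blast
qed

text \<open>A path transversal to the infinite cyclic subgroup generated by \<open>t\<close>, multiplied by an even
  number of powers of \<open>t\<close>, is a copy of a grid. Tours of the grid that start in a corner can end
  anywhere with at most two superfluous vertices, so their lengths vary by at most two.\<close>

lemma deep_maximum_grid:
  assumes t: "t \<in> S" "ord t = 0" and proper: "generate G {t} \<noteq> carrier G"
  shows "deep_maximum n"
proof -
  have tc: "t \<in> carrier G" using t S_carrier by auto
  let ?T = "generate G {t}"
  have T: "subgroup ?T G" using tc by (intro generate_is_subgroup) auto
  have T_pow: "?T = range (\<lambda>k::int. t [^] k)" using generate_pow[OF tc] by auto
  obtain y where y: "y \<in> carrier G" "y \<notin> ?T" using proper subgroup.subset[OF T] by auto
  have "S \<union> ?T \<subseteq> carrier G" using S_carrier subgroup.subset[OF T] by auto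
  moreover have "carrier G \<subseteq> generate G (S \<union> ?T)"
    using mono_generate[of S "S \<union> ?T"] generate_S by simp
  ultimately have gen: "generate G (S \<union> ?T) = carrier G" using generate_incl by blast
  let ?B = "ball \<one> (3 * n)"
  have B: "finite ?B" "?B \<subseteq> carrier G"
    using finite_cayley_ball[OF finite_S] cayley_ball_subset_carrier[OF S_carrier] by auto
  \<comment> \<open>\<open>\<one>\<close> and \<open>y\<close> lie in different cosets of
    \<open>?T\<close>; covering both forces the grid to have at least two columns.\<close>
  let ?Y = "insert \<one> (insert y ?B)"
  have "finite ?Y" "?Y \<subseteq> generate G (S \<union> ?T)" using B y(1) gen by auto
  from transversal_path_ex[OF T finite_S subset_refl this] obtain vs where
    vs: "transversal_path ?T vs"
    and cover: "\<And>x. x \<in> ?Y \<Longrightarrow> \<exists>v\<in>set vs. \<exists>u\<in>?T. x = v \<otimes> u"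
    by blast
  have vs': "vs \<noteq> []" "set vs \<subseteq> carrier G" "successively adj vs"
    "sorted_wrt (\<lambda>x y. inv x \<otimes> y \<notin> ?T) vs"
    using vs unfolding transversal_path_def by auto
  define a where "a = length vs"
  have vs_carrier: "vs ! i \<in> carrier G" if "i < a" for i
    using vs'(2) that unfolding a_def by auto
  have "a \<ge> 2"
  proof (rule ccontr)
    assume "\<not> a \<ge> 2"
    moreover have "length vs > 0" using vs'(1) by simp
    ultimately have "length vs = Suc 0" unfolding a_def by linarith
    then obtain v where v: "vs = [v]" by (auto simp: length_Suc_conv)
    then have vc: "v \<in> carrier G" using vs'(2) by simp
    obtain u u' where u: "u \<in> ?T" "\<one> = v \<otimes> u" "u' \<in> ?T" "y = v \<otimes> u'"
      using cover[of \<one>] cover[of y] v by auto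
    then have c: "u \<in> carrier G" "u' \<in> carrier G" using subgroup.subset[OF T] by auto
    have "y = inv u \<otimes> u'" using u c vc by (metis inv_equality m_comm)
    then have "y \<in> ?T" using u T by (simp add: subgroup.m_closed subgroup.m_inv_closed)
    then show False using y(2) by simp
  qed
  obtain i k where ik: "\<And>x. x \<in> ?B \<Longrightarrow> i x < a \<and> x = vs ! i x \<otimes> t [^] (k x :: int)"
  proof -
    have "\<exists>i k. i < a \<and> x = vs ! i \<otimes> t [^] (k :: int)" if "x \<in> ?B" for x
    proof -
      obtain v u where "v \<in> set vs" "u \<in> ?T" "x = v \<otimes> u" using cover[of x] \<open>x \<in> ?B\<close> by blast
      then show ?thesis unfolding a_def T_pow by (auto simp: in_set_conv_nth)
    qed
    then show thesis using that by metis
  qed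
  define M where "M = (\<Sum>x\<in>?B. \<bar>k x\<bar>)"
  have M: "\<bar>k x\<bar> \<le> M" if "x \<in> ?B" for x
    unfolding M_def using B(1) that by (intro member_le_sum) auto
  have "M \<ge> 0" unfolding M_def by (intro sum_nonneg) auto
  \<comment> \<open>The exponents, shifted by \<open>M\<close>, range from \<open>0\<close> to
    \<open>2 * M\<close>, which fits into \<open>2 * m\<close> rows; the number of rows has to be
    even.\<close>
  define m where "m = Suc (nat M)"
  \<comment> \<open>Translation by \<open>c\<close> puts the corner of the grid at the identity,
    where tours have to start.\<close>
  define c where "c = inv (vs ! 0)"
  have c: "c \<in> carrier G" unfolding c_def using vs_carrier \<open>a \<ge> 2\<close> by simp
  define g where "g = (\<lambda>(i, l). c \<otimes> t [^] int l \<otimes> vs ! i)"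
  let ?R = "{..<a} \<times> {..<2 * m}"
  define F where "F = g ` ?R"
  have g_carrier: "g p \<in> carrier G" if "p \<in> ?R" for p
    using that c tc vs_carrier unfolding g_def by auto
  have g0: "g (0, 0) = \<one>" using vs_carrier[of 0] \<open>a \<ge> 2\<close> by (simp add: g_def c_def)
  have inj: "inj_on g ?R"
  proof (rule inj_onI)
    fix p q assume p: "p \<in> ?R" and q: "q \<in> ?R" and eq: "g p = g q"
    obtain i l i' l' where il: "p = (i, l)" "q = (i', l')" by force
    have c': "vs ! i \<in> carrier G" "vs ! i' \<in> carrier G" using p q il vs_carrier by auto
    have "t [^] int l \<otimes> vs ! i = t [^] int l' \<otimes> vs ! i'"
      using eq c c' tc unfolding il g_def by (simp add: m_assoc)
    \<comment> \<open>Both orders are needed because transversality only compares a vertex with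
      later ones. It gives \<open>i = i'\<close>, and the infinite order of \<open>t\<close> then
      gives \<open>l = l'\<close>.\<close>
    then have e: "inv (vs ! i) \<otimes> vs ! i' = t [^] (int l - int l')"
      "inv (vs ! i') \<otimes> vs ! i = t [^] (int l' - int l)"
      using c' tc cross_mult[of "t [^] int l" "t [^] int l'" "vs ! i" "vs ! i'"]
        cross_mult[of "t [^] int l'" "t [^] int l" "vs ! i'" "vs ! i"]
      by (simp_all add: int_pow_diff)
    have "inv (vs ! i) \<otimes> vs ! i' \<in> ?T" "inv (vs ! i') \<otimes> vs ! i \<in> ?T" unfolding e T_pow by auto
    then have "i = i'"
      using vs'(4) p q il unfolding a_def sorted_wrt_iff_nth_less by (metis SigmaE lessThan_iff linorder_neqE_nat Pair_inject)
    then have "t [^] (int l - int l') = t [^] (0::int)" using e c' by simp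
    then have "int l - int l' = 0" by (rule int_pow_inj[OF tc t(2)])
    then show "p = q" using il \<open>i = i'\<close> by simp
  qed
  have card_F: "card F = a * (2 * m)" unfolding F_def using card_image[OF inj] by simp
  have F: "finite F" "F \<subseteq> carrier G" unfolding F_def using g_carrier by auto
  have adj_up: "adj (g (i, l)) (g (i, Suc l))" if "i < a" for i l
  proof -
    have "g (i, Suc l) = g (i, l) \<otimes> t"
      using c tc vs_carrier[OF that] unfolding g_def
      by (simp add: m_ac int_pow_int)
    then show ?thesis using t(1) c tc vs_carrier[OF that] adjI[of "g (i, l)" t] by (simp add: g_def)
  qed
  have adj_right: "adj (g (i, l)) (g (Suc i, l))" if "Suc i < a" for i l
    using vs'(3) that c tc unfolding g_def a_def
    by (auto simp: successively_conv_nth intro!: adj_translate)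
  have g_adj: "adj (g p) (g q)" if "p \<in> ?R" "q \<in> ?R" "grid_adj p q" for p q
    using that unfolding grid_adj_def
    by (cases p; cases q) (auto intro: adj_up adj_right adj_sym)
  have upper: "tour_size G S F q \<le> card F + 2" if "q \<in> F" for q
  proof -
    obtain x l where xl: "x < a" "l < 2 * m" "q = g (x, l)" using \<open>q \<in> F\<close> unfolding F_def by auto
    obtain ps where ps: "walk grid_adj (0, 0) ps (x, l)" "set ps = ?R" "length ps \<le> a * (2 * m) + 2"
      using grid_tour_even[OF \<open>a \<ge> 2\<close> xl(1,2)] unfolding grid_tour_def by blast
    have "walk adj (g (0, 0)) (map g ps) (g (x, l))"
      using ps(1) by (rule walk_map) (auto simp only: ps(2) intro: g_adj)
    then have "cayley_tour G S F (map g ps) q"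
      using g0 xl(3) ps(2) unfolding cayley_tour_def F_def by simp
    from tour_size_le[OF this] show ?thesis using ps(3) card_F by simp
  qed
  \<comment> \<open>The centre is chosen at height \<open>M\<close>: multiplying it by
    \<open>vs ! i \<otimes> t [^] k\<close> with \<open>\<bar>k\<bar> \<le> M\<close> gives the grid
    point with coordinates \<open>i\<close> and \<open>M + k\<close>.\<close>
  define b where "b = c \<otimes> t [^] M"
  have b: "b \<in> carrier G" unfolding b_def using c tc by simp
  show ?thesis
  proof (rule deep_maximumI[OF F b])
    show "ball b (Suc 2 * n) \<subseteq> F"
    proof
      fix x assume "x \<in> ball b (Suc 2 * n)"
      then have "x \<in> ball b (3 * n)" by (simp add: numeral_3_eq_3)
      then obtain z where z: "z \<in> ?B" "x = b \<otimes> z" using ball_translate[OF b] by blast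
      let ?l = "nat (M + k z)"
      have l: "int ?l = M + k z" "?l < 2 * m" using M[OF z(1)] by (auto simp: m_def)
      have "x = c \<otimes> t [^] M \<otimes> (vs ! i z \<otimes> t [^] k z)" using ik[OF z(1)] z(2) b_def by metis
      also have "\<dots> = c \<otimes> (t [^] M \<otimes> t [^] k z) \<otimes> vs ! i z"
        using c tc vs_carrier[of "i z"] conjunct1[OF ik[OF z(1)]] by (simp add: m_ac)
      also have "\<dots> = g (i z, ?l)"
        unfolding g_def using tc by (simp only: prod.case l(1) int_pow_mult)
      finally show "x \<in> F" unfolding F_def using ik[OF z(1)] l(2) by blast
    qed
    \<comment> \<open>Every tour has at least \<open>card F\<close> vertices, and the grid tours
      have at most two more.\<close>
    show "tour_size G S F q \<le> tour_size G S F b + 2" if "q \<in> F" for q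
      using upper[OF that] card_le_tour_size[OF F b] by simp
  qed
qed

section \<open>Tours of a segment of the line\<close>

lemma walk_int_pow:
  assumes "t \<in> S" "i \<le> j"
  shows "\<exists>vs. walk adj (t [^] i) vs (t [^] j) \<and> (\<forall>k. i \<le> k \<longrightarrow> k \<le> j \<longrightarrow> t [^] k \<in> set vs) \<and>
    length vs = Suc (nat (j - i))"
proof -
  have t: "t \<in> carrier G" using assms S_carrier by auto
  let ?f = "\<lambda>l. t [^] (i + int l)"
  let ?vs = "map ?f [0..<Suc (nat (j - i))]"
  have "adj (?f l) (?f (Suc l))" for l
  proof -
    have "?f (Suc l) = t [^] (i + int l + 1)" by (simp add: algebra_simps)
    also have "\<dots> = ?f l \<otimes> t" using t by (simp only: int_pow_mult int_pow_1)
    finally show ?thesis using adjI[of "?f l" t] assms(1) t by simp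
  qed
  then have "walk adj (?f 0) ?vs (?f (nat (j - i)))" by (rule walk_upt)
  moreover have "t [^] k \<in> set ?vs" if "i \<le> k" "k \<le> j" for k
  proof -
    have "?f (nat (k - i)) \<in> ?f ` {0..<Suc (nat (j - i))}" using that by (intro imageI) auto
    moreover have "?f (nat (k - i)) = t [^] k" using that by simp
    ultimately show ?thesis by (simp only: set_map set_upt)
  qed
  ultimately show ?thesis using assms(2) by (intro exI[of _ ?vs]) (simp del: upt_Suc)
qed

text \<open>Walk \<open>n\<close> steps to the end \<open>t [^] (- int n)\<close>, cross the segment
  in \<open>2 * n\<close> steps and return to \<open>t [^] k\<close> in at most \<open>n\<close>
  steps. Visiting the end farther from the target first keeps the return short.\<close>

lemma tour_segment:
  assumes t: "t \<in> S" and k: "0 \<le> k" "k \<le> int n"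
  shows "\<exists>vs. walk adj \<one> vs (t [^] k) \<and> (\<forall>j. \<bar>j\<bar> \<le> int n \<longrightarrow> t [^] j \<in> set vs) \<and> length vs \<le> 4 * n + 1"
proof -
  obtain us where us: "walk adj (t [^] (- int n)) us (t [^] (0::int))" "length us = Suc n"
    using walk_int_pow[OF t, of "- int n" 0] by auto
  obtain vs where vs: "walk adj (t [^] (- int n)) vs (t [^] int n)" "length vs = Suc (2 * n)"
    "\<And>j. - int n \<le> j \<Longrightarrow> j \<le> int n \<Longrightarrow> t [^] j \<in> set vs"
    using walk_int_pow[OF t, of "- int n" "int n"] by (auto simp: nat_mult_distrib)
  obtain ws where ws: "walk adj (t [^] k) ws (t [^] int n)" "length ws \<le> Suc n"
    using walk_int_pow[OF t, of k "int n"] k by auto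
  obtain xs where xs: "walk adj \<one> xs (t [^] int n)" "set xs = set (rev us) \<union> set vs"
    "length xs = length (rev us) + length vs - 1"
    using walk_join[OF walk_rev[OF us(1) adj_sym] vs(1)] by auto
  obtain ys where ys: "walk adj \<one> ys (t [^] k)" "set ys = set xs \<union> set (rev ws)"
    "length ys = length xs + length (rev ws) - 1"
    using walk_join[OF xs(1) walk_rev[OF ws(1) adj_sym]] by auto
  show ?thesis
  proof (intro exI conjI allI impI)
    show "t [^] j \<in> set ys" if "\<bar>j\<bar> \<le> int n" for j
      using vs(3)[of j] that xs(2) ys(2) by auto
    show "length ys \<le> 4 * n + 1" using us(2) vs(2) ws(2) xs(3) ys(3) by simp
  qed (rule ys(1))
qed

text \<open>A tour of the segment that returns to the identity needs \<open>n\<close> steps to one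
  end, \<open>2 * n\<close> to the other and \<open>n\<close> back, while no other endpoint in the
  segment requires more. So the identity is already the maximum.\<close>

lemma deep_maximum_line:
  assumes t: "t \<in> S" "ord t = 0" and S: "S \<subseteq> {\<one>, t, inv t}"
  shows "deep_maximum n"
proof -
  have tc: "t \<in> carrier G" using t S_carrier by auto
  have S_pow: "\<exists>k. \<bar>k\<bar> \<le> 1 \<and> s = t [^] (k::int)" if "s \<in> S" for s
  proof -
    from that S consider "s = \<one>" | "s = t" | "s = inv t" by blast
    then show ?thesis
    proof cases
      case 1 then show ?thesis by (intro exI[of _ 0]) simp
    next
      case 2 then show ?thesis using tc by (intro exI[of _ 1]) simp
    next
      case 3 then show ?thesis using tc by (intro exI[of _ "- 1"]) (simp add: int_pow_neg)
    qed
  qed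
  \<comment> \<open>The exponent as a coordinate on the line; it is unique because \<open>t\<close>
    has infinite order. One step changes it by at most one, and by zero for the generator
    \<open>\<one>\<close>.\<close>
  define e where "e = (\<lambda>x. THE k::int. x = t [^] k)"
  have e: "e (t [^] k) = k" for k
    unfolding e_def using int_pow_inj[OF tc t(2)] by (intro the_equality) auto
  have word_pow: "\<exists>k. \<bar>k\<bar> \<le> int (length ws) \<and> word_prod G ws = t [^] (k::int)" if "ws \<in> lists S" for ws
    using that
  proof (induction ws)
    case Nil
    then show ?case by (intro exI[of _ 0]) simp
  next
    case (Cons s ws)
    then obtain k k' where "\<bar>k\<bar> \<le> int (length ws)" "word_prod G ws = t [^] (k::int)"
      "\<bar>k'\<bar> \<le> 1" "s = t [^] (k'::int)" using S_pow by blast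
    then show ?case using tc by (intro exI[of _ "k' + k"]) (simp add: int_pow_mult)
  qed
  have pow: "x = t [^] e x" if "x \<in> carrier G" for x
    using word_ex[OF that] word_pow e by metis
  have adj_e: "\<bar>e x - e y\<bar> \<le> 1" if "adj x y" for x y
  proof -
    obtain s where s: "x \<in> carrier G" "s \<in> S" "y = x \<otimes> s" using \<open>adj x y\<close> unfolding cayley_adj_def by blast
    obtain k where k: "\<bar>k\<bar> \<le> 1" "s = t [^] (k::int)" using S_pow[OF s(2)] by blast
    have "y = t [^] (e x + k)" using pow[OF s(1)] s(3) k(2) tc by (metis int_pow_mult)
    then show ?thesis using e k(1) by simp
  qed
  define F where "F = (\<lambda>k. t [^] k) ` {- int n..int n}"
  have F: "finite F" "F \<subseteq> carrier G" using tc by (auto simp: F_def)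
  have upper: "tour_size G S F q \<le> 4 * n + 1" if q: "q \<in> F" for q
  proof -
    obtain k where k: "- int n \<le> k" "k \<le> int n" "q = t [^] k" using q unfolding F_def by auto
    have "\<exists>vs. walk adj \<one> vs q \<and> (\<forall>j. \<bar>j\<bar> \<le> int n \<longrightarrow> t [^] j \<in> set vs) \<and> length vs \<le> 4 * n + 1"
    proof (cases "0 \<le> k")
      case True
      then show ?thesis using tour_segment[OF t(1), of k n] k by simp
    next
      case False
      \<comment> \<open>Endpoints on the negative side are treated by exchanging \<open>t\<close>
        with its inverse.\<close>
      have flip: "inv t [^] (- j) = t [^] j" for j :: int
        using tc by (simp add: int_pow_inv int_pow_neg)
      obtain vs where vs: "walk adj \<one> vs (inv t [^] (- k))" "length vs \<le> 4 * n + 1"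
        "\<And>j. \<bar>j\<bar> \<le> int n \<Longrightarrow> inv t [^] j \<in> set vs"
        using tour_segment[OF S_inv[OF t(1)], of "- k" n] False k by auto
      have "t [^] j \<in> set vs" if "\<bar>j\<bar> \<le> int n" for j
        using vs(3)[of "- j"] that flip by simp
      then show ?thesis using vs(1,2) flip k(3) by metis
    qed
    then obtain vs where "cayley_tour G S F vs q" "length vs \<le> 4 * n + 1"
      unfolding cayley_tour_def F_def by force
    then show ?thesis by (blast intro: le_trans[OF tour_size_le])
  qed
  have lower: "4 * n + 1 \<le> tour_size G S F \<one>"
  proof -
    obtain vs where vs: "cayley_tour G S F vs \<one>" "length vs = tour_size G S F \<one>"
      using tour_size_witness[OF tour_ex[OF F one_closed]] .
    have w: "vs \<noteq> []" "hd vs = \<one>" "last vs = \<one>" "successively adj vs" "F \<subseteq> set vs"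
      using vs(1) unfolding cayley_tour_def walk_def by auto
    let ?L = "length vs"
    have "successively (\<lambda>x y. \<bar>e x - e y\<bar> \<le> 1) vs"
      using w(4) by (rule successively_mono) (rule adj_e)
    then have "successively (\<lambda>x y. \<bar>x - y\<bar> \<le> 1) (map e vs)" by (simp add: successively_map)
    from successively_int_diff_le[OF this]
    have dist: "\<bar>e (vs ! j) - e (vs ! i)\<bar> \<le> int (j - i)" if "i \<le> j" "j < ?L" for i j
      using that by simp
    have "t [^] int n \<in> F" "t [^] (- int n) \<in> F" unfolding F_def by auto
    then obtain i j where ij: "i < ?L" "vs ! i = t [^] int n" "j < ?L" "vs ! j = t [^] (- int n)"
      using w(5) by (metis in_set_conv_nth subsetD)
    have "e \<one> = 0" using e[of 0] by simp
    then have ends: "e (vs ! 0) = 0" "e (vs ! (?L - 1)) = 0"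
      using w(1-3) by (simp_all add: hd_conv_nth last_conv_nth)
    have eij: "e (vs ! i) = int n" "e (vs ! j) = - int n" using ij e by simp_all
    have "4 * n + 1 \<le> ?L"
    \<comment> \<open>The cases differ in which end of the segment the tour reaches first.\<close>
    proof (cases "i \<le> j")
      case True
      have "int n \<le> int i" "2 * int n \<le> int (j - i)" "int n \<le> int (?L - 1 - j)"
        using dist[of 0 i] dist[of i j] dist[of j "?L - 1"] True ij(1,3) ends eij by simp_all
      then show ?thesis using True ij(3) by linarith
    next
      case False
      have "int n \<le> int j" "2 * int n \<le> int (i - j)" "int n \<le> int (?L - 1 - i)"
        using dist[of 0 j] dist[of j i] dist[of i "?L - 1"] False ij(1,3) ends eij by simp_all
      then show ?thesis using False ij(1) by linarith
    qed
    then show ?thesis using vs(2) by simp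
  qed
  have ball: "ball \<one> n \<subseteq> F"
  proof
    fix x assume "x \<in> ball \<one> n"
    then obtain ws where ws: "ws \<in> lists S" "length ws \<le> n" "x = \<one> \<otimes> word_prod G ws"
      unfolding cayley_ball_def by blast
    obtain k where "\<bar>k\<bar> \<le> int (length ws)" "word_prod G ws = t [^] (k::int)"
      using word_pow[OF ws(1)] by blast
    then show "x \<in> F" unfolding F_def using ws(2,3) tc by (intro image_eqI[of _ _ k]) auto
  qed
  show ?thesis
  proof (intro exI conjI ballI)
    show "tour_size G S F q' \<le> tour_size G S F \<one>" if "q' \<in> ball \<one> n" for q'
      using upper[OF subsetD[OF ball that]] lower by linarith
  qed (use F ball in simp_all)
qed

text \<open>If every generator has finite order, the group is finite. If one of infinite order
  generates a proper subgroup, there is a grid. Otherwise each generator of infinite order generates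
  the whole group, which forces the line.\<close>

lemma deep_maximum: "deep_maximum n"
proof (cases "\<forall>s\<in>S. ord s \<noteq> 0")
  case True
  then show ?thesis by (intro deep_maximum_finite finite_carrier_if_torsion) blast
next
  case False
  then obtain t where t: "t \<in> S" "ord t = 0" by blast
  then have tc: "t \<in> carrier G" using S_carrier by auto
  show ?thesis
  proof (cases "\<exists>s\<in>S. ord s = 0 \<and> generate G {s} \<noteq> carrier G")
    case True
    then show ?thesis using deep_maximum_grid by blast
  next
    case False
    then have cyclic: "\<exists>k::int. x = s [^] k" if "s \<in> S" "ord s = 0" "x \<in> carrier G" for s x
      using that generate_pow[of s] S_carrier by blast
    have "s \<in> {\<one>, t, inv t}" if s: "s \<in> S" for s
    proof -
      have sc: "s \<in> carrier G" using s S_carrier by auto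
      obtain k where k: "s = t [^] (k::int)" using cyclic[OF t sc] by blast
      show ?thesis
      proof (cases "k = 0")
        case True
        then show ?thesis using k by simp
      next
        case False
        \<comment> \<open>A nontrivial power \<open>s\<close> of \<open>t\<close> has infinite order
          too, so it generates the group and \<open>t = s [^] l\<close>; then
          \<open>k * l = 1\<close> leaves only \<open>t\<close> and its inverse.\<close>
        have "t [^] (k * int (ord s)) = s [^] int (ord s)" using k tc by (simp add: int_pow_pow)
        also have "\<dots> = t [^] (0::int)" using sc by (simp add: int_pow_int)
        finally have "k * int (ord s) = 0" by (rule int_pow_inj[OF tc t(2)])
        then have "ord s = 0" using False by simp
        then obtain l where l: "t = s [^] (l::int)" using cyclic[OF s _ tc] by blast
        have "t [^] (k * l) = t [^] (1::int)" using k l tc by (simp add: int_pow_pow[symmetric])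
        then have "k * l = 1" by (rule int_pow_inj[OF tc t(2)])
        then have "k = 1 \<or> k = - 1" by (simp add: zmult_eq_1_iff) blast
        then show ?thesis using k tc by (auto simp: int_pow_neg)
      qed
    qed
    then show ?thesis by (intro deep_maximum_line[OF t]) blast
  qed
qed

end

theorem proposition4p15:
  fixes A :: "('a, 'm) monoid_scheme" and B :: "('b, 'n) monoid_scheme"
    and S\<^sub>A :: "'a set" and S\<^sub>B :: "'b set"
  assumes "group A" and "carrier A \<noteq> {\<one>\<^bsub>A\<^esub>}"
    and "finite_symmetric_generating_set A S\<^sub>A"
    and "unbounded_depth A S\<^sub>A"
    and "comm_group B"
    and "finite_symmetric_generating_set B S\<^sub>B"
  shows "unbounded_depth (wreath_product A B) (wreath_standard_gens A B S\<^sub>A S\<^sub>B)"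
proof -
  interpret B: abelian_cayley B S\<^sub>B
    using assms(5,6) by (simp add: abelian_cayley_def abelian_cayley_axioms_def)
  interpret A: group A by fact
  have S\<^sub>A: "S\<^sub>A \<subseteq> carrier A" "\<And>s. s \<in> S\<^sub>A \<Longrightarrow> inv\<^bsub>A\<^esub> s \<in> S\<^sub>A" "generate A S\<^sub>A = carrier A"
    using assms(3) unfolding finite_symmetric_generating_set_def by auto
  interpret wreath_generators A B S\<^sub>A S\<^sub>B
    by unfold_locales (use S\<^sub>A A.generate_word[OF S\<^sub>A(1,2)] B.S_carrier in auto)
  show ?thesis
    by (rule unbounded_depth_wreath[OF assms(2,4) B.tour_ex B.deep_maximum])
qed

end
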